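(* Let $d,k,N\ge 1$ and $1\le m\le N$ be integers, let $1\le p\le\infty$, let $\varphi_1,\dots,\varphi_k:\mathbb R^d\to\mathbb C$ be continuous functions, let $\alpha^0,\alpha^1,\dots,\alpha^N\in\mathbb R_+^k$, $\mathcal A=\{\alpha^1,\dots,\alpha^N\}$, and let $\delta_1,\dots,\delta_N>0$. Let the operators $\Lambda_j$, the class $W=W_p^{\mathcal A}(\mathbb R^d,\overline\delta)$, the error $e(\Lambda_0,W,\delta,\Phi)$, the error of optimal recovery $E(\Lambda_0,W,\delta)$, the function $S$, the indices $j_1,\dots,j_l$, the numbers $\theta_{j_1},\dots,\theta_{j_l}$ and the set $M$ be as defined in the context. Assume that $\alpha^0\in\operatorname{co}\mathcal A$ and that for any $a_1,\dots,a_k>0$ there exists $\widehat\xi\in\mathbb R^d$ such that $|\varphi_j(\widehat\xi)|=a_j$, $j=1,\dots,k$. Then $$E(\Lambda_0,W_p^{\mathcal A}(\mathbb R^d,\overline\delta),\delta)=e^{-S(\alpha^0)}.$$ If $M\neq\emptyset$, then every method of the form $$\Phi(y)(\cdot)=\sum_{j\in M}a_j(\cdot)\,y_j(\cdot),$$ where $a_{j_1},\dots,a_{j_l}:\mathbb R^d\to\mathbb C$ are measurable functions satisfying, for almost all $\xi\in\mathbb R^d$, $$\sum_{s=1}^l\varphi^{\alpha^{j_s}}(\xi)\,a_{j_s}(\xi)=\varphi^{\alpha^0}(\xi)$$ and $$\begin{cases}\displaystyle\sum_{s=1}^l\frac{\delta_{j_s}^{p'}|a_{j_s}(\xi)|^{p'}}{\theta_{j_s}^{p'/p}}\le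 e^{-p'S(\alpha^0)}, & 1<p<\infty,\ \frac1p+\frac1{p'}=1,\\[2mm] \displaystyle\max_{1\le s\le l}\frac{\delta_{j_s}|a_{j_s}(\xi)|}{\theta_{j_s}}\le e^{-S(\alpha^0)}, & p=1,\\[2mm] \displaystyle\sum_{s=1}^l|a_{j_s}(\xi)|\,\delta_{j_s}\le e^{-S(\alpha^0)}, & p=\infty,\end{cases}$$ is optimal, i.e. $e(\Lambda_0,W,\delta,\Phi)=E(\Lambda_0,W,\delta)$. If $M=\emptyset$, then the method $\Phi(y)=0$ is optimal.
   Context: Notation. $\mathbb R_+=[0,\infty)$. For $\alpha=(\alpha_1,\dots,\alpha_k)\in\mathbb R_+^k$, $\varphi^\alpha(\xi)=\varphi_1(\xi)^{\alpha_1}\cdots\varphi_k(\xi)^{\alpha_k}$, where for complex-valued $\varphi_i$ the powers are taken with a fixed measurable branch, so that $|\varphi^\alpha(\xi)|=|\varphi_1(\xi)|^{\alpha_1}\cdots|\varphi_k(\xi)|^{\alpha_k}$ (with $0^0=1$). $\operatorname{co}$ denotes the convex hull. $L_p(\mathbb R^d)$ consists of complex-valued functions, with Lebesgue measure. Spaces and operators. $\mathcal W_p^{\mathcal A}(\mathbb R^d)=\{x\in L_p(\mathbb R^d):\varphi^{\alpha^j}x\in L_p(\mathbb R^d),\ j=1,\dots,N\}$. For $j=0,1,\dots,N$, $\Lambda_j:\mathcal W_p^{\mathcal A}(\mathbb R^d)\to L_p(\mathbb R^d)$ is $\Lambda_jx=\varphi^{\alpha^j}x$ (for $\alpha^0\in\operatorname{co}\mathcal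 A$ this is well defined also for $j=0$). With $\overline\delta=(\delta_{m+1},\dots,\delta_N)$ and $\delta=(\delta_1,\dots,\delta_m)$, $$W=W_p^{\mathcal A}(\mathbb R^d,\overline\delta)=\{x\in\mathcal W_p^{\mathcal A}(\mathbb R^d):\|\Lambda_jx\|_{L_p(\mathbb R^d)}\le\delta_j,\ j=m+1,\dots,N\}$$ (if $m=N$ there is no constraint and $W=\mathcal W_p^{\mathcal A}(\mathbb R^d)$). Recovery problem. A recovery method is an arbitrary map $\Phi:(L_p(\mathbb R^d))^m\to L_p(\mathbb R^d)$. Its error is $$e(\Lambda_0,W,\delta,\Phi)=\sup\{\|\Lambda_0x-\Phi(y)\|_{L_p(\mathbb R^d)}:\ x\in W,\ y=(y_1,\dots,y_m)\in(L_p(\mathbb R^d))^m,\ \|\Lambda_jx-y_j\|_{L_p(\mathbb R^d)}\le\delta_j,\ j=1,\dots,m\}.$$ The error of optimal recovery is $E(\Lambda_0,W,\delta)=\inf_\Phi e(\Lambda_0,W,\delta,\Phi)$, the infimum being over all methods; a method attaining the infimum is called optimal. The function $S$ and the data $j_s,\theta_{j_s},M$. Let $Q=\operatorname{co}\{(\alpha^1,\ln(1/\delta_1)),\dots,(\alpha^N,\ln(1/\delta_N))\}\subset\mathbb R^{k+1}$ and $S(\alpha)=\max\{z\in\mathbb R:(\alpha,z)\in Q\}$ for $\alpha\in\mathbb R^k$ ($S(\alpha)=-\infty$ if no such $z$ exists). For $\alpha^0\in\operatorname{co}\mathcal A$, let $z=\langle\alpha,\widehat\eta\rangle+\widehat a$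 (with $\widehat\eta\in\mathbb R^k$, $\widehat a\in\mathbb R$) be a support hyperplane to the graph of $S$ at $\alpha^0$, i.e. $S(\alpha)\le\langle\alpha,\widehat\eta\rangle+\widehat a$ for all $\alpha$, with equality at $\alpha=\alpha^0$. By Carathéodory's theorem there are distinct indices $j_1,\dots,j_l\in\{1,\dots,N\}$, $l\le k+1$, such that the points $(\alpha^{j_s},\ln(1/\delta_{j_s}))$ lie on this hyperplane and $$\alpha^0=\sum_{s=1}^l\theta_{j_s}\alpha^{j_s},\qquad\theta_{j_s}>0,\qquad\sum_{s=1}^l\theta_{j_s}=1.$$ Fix any such choice and set $M=\{j_1,\dots,j_l\}\cap\{1,\dots,m\}$. *)

theory Defs
  imports "HOL-Analysis.Analysis" "HOL-Probability.Essential_Supremum"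
begin

text \<open>
  Elements of \<open>L\<^sub>p\<close> are represented by Lebesgue measurable functions; the identification of functions
  that agree almost everywhere is imposed on recovery methods in \<open>recovery_methods\<close> below.
\<close>

definition lp_norm :: "ennreal \<Rightarrow> ('a::euclidean_space \<Rightarrow> complex) \<Rightarrow> ennreal" where
  "lp_norm p f =
    (if p = \<infinity> then esssup lebesgue (\<lambda>\<xi>. ennreal (cmod (f \<xi>)))
     else let I = (\<integral>\<^sup>+ \<xi>. ennreal (cmod (f \<xi>) powr enn2real p) \<partial>lebesgue)
          in if I = \<infinity> then \<infinity> else ennreal (enn2real I powr (1 / enn2real p)))"

definition Lp :: "ennreal \<Rightarrow> ('a::euclidean_space \<Rightarrow> complex) set" where
  "Lp p = {f. f \<in> borel_measurable lebesgue \<and> lp_norm p f < \<infinity>}"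

definition conj_exponent :: "real \<Rightarrow> real" where
  "conj_exponent r = r / (r - 1)"

lemma conj_exponent_iff:
  assumes "1 < r"
  shows "q = conj_exponent r \<longleftrightarrow> 1 / r + 1 / q = 1"
proof (cases "q = 0")
  case True
  then show ?thesis using assms by (simp add: conj_exponent_def)
next
  case False
  then have "1 / r + 1 / q = 1 \<longleftrightarrow> q + r = q * r"
    using False assms by (auto simp: field_simps)
  also have "\<dots> \<longleftrightarrow> q = r / (r - 1)"
    using assms by (auto simp: field_simps)
  finally show ?thesis by (simp add: conj_exponent_def)
qed

text \<open>
  A branch of complex powers is given by a Borel measurable choice \<open>\<omega>\<close> of the argument:
  \<open>z\<^sup>a = |z|\<^sup>a exp(\<i> a \<omega>(z))\<close>. The value at \<open>z = 0\<close> is separate because \<open>0 powr 0 = 0\<close> in the library.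
\<close>

definition arg_branch :: "(complex \<Rightarrow> real) \<Rightarrow> bool" where
  "arg_branch \<omega> \<longleftrightarrow>
    \<omega> \<in> borel_measurable borel \<and> (\<forall>z. z = complex_of_real (cmod z) * cis (\<omega> z))"

definition branch_power :: "(complex \<Rightarrow> real) \<Rightarrow> complex \<Rightarrow> real \<Rightarrow> complex" where
  "branch_power \<omega> z a =
    (if z = 0 then (if a = 0 then 1 else 0)
     else complex_of_real (cmod z powr a) * cis (a * \<omega> z))"

definition multi_power ::
  "(complex \<Rightarrow> real) \<Rightarrow> ('k::finite \<Rightarrow> 'a \<Rightarrow> complex) \<Rightarrow> real ^ 'k \<Rightarrow> 'a \<Rightarrow> complex" where
  "multi_power \<omega> \<phi> \<beta> \<xi> = (\<Prod>i\<in>UNIV. branch_power \<omega> (\<phi> i \<xi>) (\<beta> $ i))"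

definition \<Lambda>_op ::
  "(complex \<Rightarrow> real) \<Rightarrow> ('k::finite \<Rightarrow> 'a \<Rightarrow> complex) \<Rightarrow> (nat \<Rightarrow> real ^ 'k) \<Rightarrow>
    nat \<Rightarrow> ('a \<Rightarrow> complex) \<Rightarrow> 'a \<Rightarrow> complex" where
  "\<Lambda>_op \<omega> \<phi> \<alpha> j x = (\<lambda>\<xi>. multi_power \<omega> \<phi> (\<alpha> j) \<xi> * x \<xi>)"

definition W_space ::
  "ennreal \<Rightarrow> (nat \<Rightarrow> ('a::euclidean_space \<Rightarrow> complex) \<Rightarrow> 'a \<Rightarrow> complex) \<Rightarrow> nat \<Rightarrow>
    ('a \<Rightarrow> complex) set" where
  "W_space p \<Lambda> N = {x \<in> Lp p. \<forall>j\<in>{1..N}. \<Lambda> j x \<in> Lp p}"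

definition W_class ::
  "ennreal \<Rightarrow> (nat \<Rightarrow> ('a::euclidean_space \<Rightarrow> complex) \<Rightarrow> 'a \<Rightarrow> complex) \<Rightarrow> nat \<Rightarrow> nat \<Rightarrow>
    (nat \<Rightarrow> real) \<Rightarrow> ('a \<Rightarrow> complex) set" where
  "W_class p \<Lambda> m N \<delta> =
    {x \<in> W_space p \<Lambda> N. \<forall>j\<in>{m+1..N}. lp_norm p (\<Lambda> j x) \<le> ennreal (\<delta> j)}"

text \<open>
  Maps \<open>(L\<^sub>p)\<^sup>m \<rightarrow> L\<^sub>p\<close>: a tuple is a family of which only the entries \<open>1, \<dots>, m\<close> matter, and the second
  condition says that the map is well defined on almost-everywhere classes.
\<close>

definition recovery_methods ::
  "ennreal \<Rightarrow> nat \<Rightarrow> ((nat \<Rightarrow> 'a::euclidean_space \<Rightarrow> complex) \<Rightarrow> 'a \<Rightarrow> complex) set" where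
  "recovery_methods p m =
    {\<Phi>. (\<forall>y \<in> {1..m} \<rightarrow> Lp p. \<Phi> y \<in> Lp p) \<and>
        (\<forall>y \<in> {1..m} \<rightarrow> Lp p. \<forall>y' \<in> {1..m} \<rightarrow> Lp p.
           (\<forall>j\<in>{1..m}. AE \<xi> in lebesgue. y j \<xi> = y' j \<xi>) \<longrightarrow>
           (AE \<xi> in lebesgue. \<Phi> y \<xi> = \<Phi> y' \<xi>))}"

definition recovery_error ::
  "ennreal \<Rightarrow> (nat \<Rightarrow> ('a::euclidean_space \<Rightarrow> complex) \<Rightarrow> 'a \<Rightarrow> complex) \<Rightarrow>
    ('a \<Rightarrow> complex) set \<Rightarrow> nat \<Rightarrow> (nat \<Rightarrow> real) \<Rightarrow>
    ((nat \<Rightarrow> 'a \<Rightarrow> complex) \<Rightarrow> 'a \<Rightarrow> complex) \<Rightarrow> ennreal" where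
  "recovery_error p \<Lambda> W m \<delta> \<Phi> =
    Sup {lp_norm p (\<lambda>\<xi>. \<Lambda> 0 x \<xi> - \<Phi> y \<xi>) | x y.
      x \<in> W \<and> y \<in> {1..m} \<rightarrow> Lp p \<and>
      (\<forall>j\<in>{1..m}. lp_norm p (\<lambda>\<xi>. \<Lambda> j x \<xi> - y j \<xi>) \<le> ennreal (\<delta> j))}"

definition optimal_error ::
  "ennreal \<Rightarrow> (nat \<Rightarrow> ('a::euclidean_space \<Rightarrow> complex) \<Rightarrow> 'a \<Rightarrow> complex) \<Rightarrow>
    ('a \<Rightarrow> complex) set \<Rightarrow> nat \<Rightarrow> (nat \<Rightarrow> real) \<Rightarrow> ennreal" where
  "optimal_error p \<Lambda> W m \<delta> = (INF \<Phi>\<in>recovery_methods p m. recovery_error p \<Lambda> W m \<delta> \<Phi>)"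

definition optimal_method ::
  "ennreal \<Rightarrow> (nat \<Rightarrow> ('a::euclidean_space \<Rightarrow> complex) \<Rightarrow> 'a \<Rightarrow> complex) \<Rightarrow>
    ('a \<Rightarrow> complex) set \<Rightarrow> nat \<Rightarrow> (nat \<Rightarrow> real) \<Rightarrow>
    ((nat \<Rightarrow> 'a \<Rightarrow> complex) \<Rightarrow> 'a \<Rightarrow> complex) \<Rightarrow> bool" where
  "optimal_method p \<Lambda> W m \<delta> \<Phi> \<longleftrightarrow>
    \<Phi> \<in> recovery_methods p m \<and> recovery_error p \<Lambda> W m \<delta> \<Phi> = optimal_error p \<Lambda> W m \<delta>"

definition Q_set ::
  "(nat \<Rightarrow> real ^ 'k) \<Rightarrow> (nat \<Rightarrow> real) \<Rightarrow> nat \<Rightarrow> ((real ^ 'k) \<times> real) set" where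
  "Q_set \<alpha> \<delta> N = convex hull ((\<lambda>j. (\<alpha> j, ln (1 / \<delta> j))) ` {1..N})"

text \<open>The greatest element exists whenever the fibre is nonempty, since the convex hull is compact.\<close>

definition S_fun ::
  "(nat \<Rightarrow> real ^ 'k) \<Rightarrow> (nat \<Rightarrow> real) \<Rightarrow> nat \<Rightarrow> real ^ 'k \<Rightarrow> ereal" where
  "S_fun \<alpha> \<delta> N \<beta> =
    (if \<exists>z. (\<beta>, z) \<in> Q_set \<alpha> \<delta> N then ereal (GREATEST z. (\<beta>, z) \<in> Q_set \<alpha> \<delta> N) else -\<infinity>)"

definition support_hyperplane ::
  "(real ^ 'k \<Rightarrow> ereal) \<Rightarrow> real ^ 'k \<Rightarrow> real ^ 'k \<Rightarrow> real \<Rightarrow> bool" where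
  "support_hyperplane S \<beta>0 \<eta> c \<longleftrightarrow>
    (\<forall>\<beta>. S \<beta> \<le> ereal (\<beta> \<bullet> \<eta> + c)) \<and> S \<beta>0 = ereal (\<beta>0 \<bullet> \<eta> + c)"

text \<open>\<open>J\<close> is the set of the distinct indices \<open>j\<^sub>1, \<dots>, j\<^sub>l\<close>.\<close>

definition caratheodory_data ::
  "(nat \<Rightarrow> real ^ 'k) \<Rightarrow> (nat \<Rightarrow> real) \<Rightarrow> nat \<Rightarrow> nat set \<Rightarrow> (nat \<Rightarrow> real) \<Rightarrow> bool" where
  "caratheodory_data \<alpha> \<delta> N J \<theta> \<longleftrightarrow>
    (\<exists>\<eta> c. support_hyperplane (S_fun \<alpha> \<delta> N) (\<alpha> 0) \<eta> c \<and>
           (\<forall>j\<in>J. ln (1 / \<delta> j) = \<alpha> j \<bullet> \<eta> + c)) \<and>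
    J \<subseteq> {1..N} \<and> card J \<le> CARD('k) + 1 \<and>
    \<alpha> 0 = (\<Sum>j\<in>J. \<theta> j *\<^sub>R \<alpha> j) \<and> (\<forall>j\<in>J. 0 < \<theta> j) \<and> (\<Sum>j\<in>J. \<theta> j) = 1"

definition weight_bound ::
  "ennreal \<Rightarrow> (nat \<Rightarrow> real) \<Rightarrow> nat set \<Rightarrow> (nat \<Rightarrow> real) \<Rightarrow> real \<Rightarrow> (nat \<Rightarrow> complex) \<Rightarrow> bool" where
  "weight_bound p \<delta> J \<theta> s b \<longleftrightarrow>
    (if p = \<infinity> then (\<Sum>j\<in>J. cmod (b j) * \<delta> j) \<le> exp (- s)
     else if p = 1 then (MAX j\<in>J. \<delta> j * cmod (b j) / \<theta> j) \<le> exp (- s)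
     else let r = enn2real p; q = conj_exponent r in
       (\<Sum>j\<in>J. \<delta> j powr q * cmod (b j) powr q / \<theta> j powr (q / r)) \<le> exp (- q * s))"

end

theory Submission
  imports Defs
begin

text \<open>
  Upper bound: with \<open>g\<^sub>j = \<Lambda>\<^sub>j x - y\<^sub>j\<close> for \<open>j \<in> M\<close> and \<open>g\<^sub>j = \<Lambda>\<^sub>j x\<close> otherwise, the representation of
  \<open>\<phi>\<close> to the power \<open>\<alpha> 0\<close> gives \<open>\<Lambda>\<^sub>0 x - \<Phi> y = (\<Sum>j\<in>J. a\<^sub>j g\<^sub>j)\<close> with \<open>\<parallel>g\<^sub>j\<parallel> \<le> \<delta>\<^sub>j\<close>, and the weight condition is the
  dual one in Hoelder's inequality for the weights \<open>\<theta>\<^sub>j\<close>.  Weights \<open>a\<^sub>j\<close> with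
  \<open>\<delta>\<^sub>j |a\<^sub>j| \<le> \<theta>\<^sub>j exp (- S)\<close>, which serve all \<open>p\<close> at once, exist by the weighted AM-GM inequality.
  Lower bound: for \<open>x \<in> W\<close> with \<open>\<parallel>\<Lambda>\<^sub>j x\<parallel> \<le> \<delta>\<^sub>j\<close> for all \<open>j\<close>, both \<open>x\<close> and \<open>-x\<close> are compatible with \<open>y = 0\<close>, so
  no method has an error below \<open>\<parallel>\<Lambda>\<^sub>0 x\<parallel>\<close>.  Take \<open>x\<close> supported near a point where
  \<open>|\<phi>\<^sub>i| = exp (- \<eta>\<^sub>i)\<close>, with \<open>\<eta>\<close> the slope of an almost supporting hyperplane of \<open>S\<close> at \<open>\<alpha> 0\<close>.
\<close>

subsection \<open>Norms\<close>

lemma one_le_enn2real: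
  assumes "1 \<le> p" "p \<noteq> \<infinity>"
  shows "1 \<le> enn2real p"
  using assms by (metis enn2real_mono enn2real_1 infinity_ennreal_def top.not_eq_extremum)

lemma one_less_enn2real:
  assumes "1 \<le> p" "p \<noteq> 1" "p \<noteq> \<infinity>"
  shows "1 < enn2real p"
  using assms one_le_enn2real[of p]
  by (metis ennreal_1 ennreal_enn2real infinity_ennreal_def order_le_less top.not_eq_extremum)

lemma lp_norm_infinity_le_iff:
  assumes "f \<in> borel_measurable lebesgue" "0 \<le> C"
  shows "lp_norm \<infinity> f \<le> ennreal C \<longleftrightarrow> (AE \<xi> in lebesgue. cmod (f \<xi>) \<le> C)"
proof
  assume *: "lp_norm \<infinity> f \<le> ennreal C"
  have "AE \<xi> in lebesgue. ennreal (cmod (f \<xi>)) \<le> lp_norm \<infinity> f"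
    unfolding lp_norm_def by (simp add: esssup_AE)
  then show "AE \<xi> in lebesgue. cmod (f \<xi>) \<le> C"
    by eventually_elim (metis * assms(2) ennreal_le_iff order_trans)
next
  assume *: "AE \<xi> in lebesgue. cmod (f \<xi>) \<le> C"
  have "(\<lambda>\<xi>. ennreal (cmod (f \<xi>))) \<in> borel_measurable lebesgue"
    using assms(1) by measurable
  moreover have "AE \<xi> in lebesgue. ennreal (cmod (f \<xi>)) \<le> ennreal C"
    using * by eventually_elim (rule ennreal_leI)
  ultimately show "lp_norm \<infinity> f \<le> ennreal C"
    unfolding lp_norm_def by (simp add: esssup_I)
qed

text \<open>Raising to the power \<open>r\<close> is increasing on the nonnegative reals, with
  inverse the power \<open>1 / r\<close>. Norm estimates for finite \<open>p\<close> can therefore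
  be made on the integral, without taking roots.\<close>

lemma lp_norm_le_iff:
  assumes p: "1 \<le> p" "p \<noteq> \<infinity>" and C: "0 \<le> C"
  defines "r \<equiv> enn2real p"
  shows "lp_norm p f \<le> ennreal C \<longleftrightarrow>
    (\<integral>\<^sup>+ \<xi>. ennreal (cmod (f \<xi>) powr r) \<partial>lebesgue) \<le> ennreal (C powr r)"
proof -
  have r: "1 \<le> r" using one_le_enn2real[OF p] by (simp add: r_def)
  define I where "I = (\<integral>\<^sup>+ \<xi>. ennreal (cmod (f \<xi>) powr r) \<partial>lebesgue)"
  show ?thesis
  proof (cases "I = \<infinity>")
    case True
    then show ?thesis using p
      by (simp add: lp_norm_def Let_def flip: r_def I_def) (simp add: top_unique)
  next
    case False
    then obtain t where t: "0 \<le> t" "I = ennreal t"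
      by (metis ennreal_cases infinity_ennreal_def)
    have "lp_norm p f = ennreal (t powr (1 / r))"
      using p False t by (simp add: lp_norm_def Let_def flip: r_def I_def)
    moreover have "t powr (1 / r) \<le> C \<longleftrightarrow> t \<le> C powr r"
    proof
      assume "t powr (1 / r) \<le> C"
      then have "(t powr (1 / r)) powr r \<le> C powr r" using r by (intro powr_mono2) auto
      then show "t \<le> C powr r" using r t by (simp add: powr_powr)
    next
      assume "t \<le> C powr r"
      then have "t powr (1 / r) \<le> (C powr r) powr (1 / r)" using r t by (intro powr_mono2) auto
      then show "t powr (1 / r) \<le> C" using r C by (simp add: powr_powr)
    qed
    ultimately show ?thesis using C t by (simp flip: I_def)
  qed
qed

lemma lp_norm_0:
  assumes "1 \<le> p"
  shows "lp_norm p (\<lambda>_. 0) = 0"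
proof -
  have "lp_norm p (\<lambda>_. 0) \<le> ennreal 0"
  proof (cases "p = \<infinity>")
    case True
    show ?thesis unfolding True by (subst lp_norm_infinity_le_iff) simp_all
  next
    case False
    show ?thesis using assms False by (subst lp_norm_le_iff) simp_all
  qed
  then show ?thesis by simp
qed

lemma lp_norm_AE_cong:
  assumes "f \<in> borel_measurable lebesgue" "g \<in> borel_measurable lebesgue"
    and "AE \<xi> in lebesgue. f \<xi> = g \<xi>"
  shows "lp_norm p f = lp_norm p g"
proof -
  have "esssup lebesgue (\<lambda>\<xi>. ennreal (cmod (f \<xi>))) = esssup lebesgue (\<lambda>\<xi>. ennreal (cmod (g \<xi>)))"
  proof (rule esssup_AE_cong)
    show "AE \<xi> in lebesgue. ennreal (cmod (f \<xi>)) = ennreal (cmod (g \<xi>))"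
      using assms(3) by eventually_elim simp
  qed (use assms in measurable)
  moreover have "(\<integral>\<^sup>+ \<xi>. ennreal (cmod (f \<xi>) powr r) \<partial>lebesgue) =
      (\<integral>\<^sup>+ \<xi>. ennreal (cmod (g \<xi>) powr r) \<partial>lebesgue)" for r
    by (rule nn_integral_cong_AE) (use assms(3) in eventually_elim, simp)
  ultimately show ?thesis by (simp add: lp_norm_def)
qed

lemma LpE:
  assumes "f \<in> Lp p"
  obtains C where "f \<in> borel_measurable lebesgue" "0 \<le> C" "lp_norm p f \<le> ennreal C"
  using assms unfolding Lp_def
  by (metis (mono_tags, lifting) enn2real_nonneg ennreal_enn2real infinity_ennreal_def mem_Collect_eq order_refl)

subsection \<open>Hoelder's inequality with weights\<close>

text \<open>Hoelder's inequality for the measure with masses \<open>\<theta> j\<close>, with the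
  dual factor already normalised. It follows from Young's inequality applied termwise to
  \<open>c j\<close> and \<open>v j / w\<close>, where \<open>w\<close> is the weighted norm of
  \<open>v\<close> with exponent \<open>r\<close>.\<close>

lemma weighted_Holder_sum:
  fixes c v \<theta> :: "'i \<Rightarrow> real"
  assumes "finite J" and \<theta>: "\<And>j. j \<in> J \<Longrightarrow> 0 < \<theta> j"
    and c: "\<And>j. j \<in> J \<Longrightarrow> 0 \<le> c j" and v: "\<And>j. j \<in> J \<Longrightarrow> 0 \<le> v j"
    and r: "1 < r" and q: "1 / r + 1 / q = 1"
    and le: "(\<Sum>j\<in>J. \<theta> j * c j powr q) \<le> 1"
  shows "(\<Sum>j\<in>J. \<theta> j * c j * v j) powr r \<le> (\<Sum>j\<in>J. \<theta> j * v j powr r)"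
proof -
  define V where "V = (\<Sum>j\<in>J. \<theta> j * v j powr r)"
  have q1: "1 < q"
  proof -
    have "1 / q = 1 - 1 / r" using q by simp
    also have "\<dots> > 0" using r by simp
    finally have "0 < q" by simp
    moreover have "1 / q < 1" using q r by (smt (verit) divide_pos_pos)
    ultimately show ?thesis by (simp add: field_simps)
  qed
  have V0: "0 \<le> V" unfolding V_def using \<theta> by (intro sum_nonneg mult_nonneg_nonneg) (auto simp: less_imp_le)
  show ?thesis
  \<comment> \<open>Division by the norm of \<open>v\<close> requires \<open>V\<close> to be
    nonzero; if \<open>V = 0\<close>, positivity of the weights makes every \<open>v j\<close>
    vanish.\<close>
  proof (cases "V = 0")
    case True
    have "v j = 0" if "j \<in> J" for j
    proof -
      have "\<theta> j * v j powr r = 0"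
        using True that \<theta> \<open>finite J\<close> unfolding V_def
        by (subst (asm) sum_nonneg_eq_0_iff) (auto simp: less_imp_le)
      then show ?thesis using \<theta>[OF that] by simp
    qed
    then show ?thesis by simp
  next
    case False
    then have V: "0 < V" using V0 by simp
    define w where "w = V powr (1 / r)"
    have w: "0 < w" "w powr r = V" using V r by (auto simp: w_def powr_powr)
    have "(\<Sum>j\<in>J. \<theta> j * c j * v j) / w = (\<Sum>j\<in>J. \<theta> j * (c j * (v j / w)))"
      by (simp add: sum_divide_distrib mult.assoc)
    also have "\<dots> \<le> (\<Sum>j\<in>J. \<theta> j * (c j powr q / q + (v j / w) powr r / r))"
    proof (intro sum_mono mult_left_mono)
      fix j assume j: "j \<in> J"
      show "c j * (v j / w) \<le> c j powr q / q + (v j / w) powr r / r"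
        using q by (intro Youngs_inequality q1 r c[OF j] divide_nonneg_pos v[OF j] w) simp
      show "0 \<le> \<theta> j" using \<theta>[OF j] by simp
    qed
    also have "\<dots> = (\<Sum>j\<in>J. \<theta> j * c j powr q) / q + V / (V * r)"
    proof -
      have "(\<Sum>j\<in>J. \<theta> j * ((v j / w) powr r / r)) = (\<Sum>j\<in>J. \<theta> j * v j powr r / (V * r))"
        using w v by (intro sum.cong) (auto simp: powr_divide less_imp_le)
      also have "\<dots> = V / (V * r)" by (simp only: V_def flip: sum_divide_distrib)
      finally show ?thesis by (simp add: sum_divide_distrib distrib_left sum.distrib)
    qed
    also have "\<dots> \<le> 1 / q + 1 / r"
      using le q1 V by (intro add_mono divide_right_mono) auto
    finally have "(\<Sum>j\<in>J. \<theta> j * c j * v j) \<le> w"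
      using q w by (simp add: add.commute)
    then have "(\<Sum>j\<in>J. \<theta> j * c j * v j) powr r \<le> w powr r"
      using r \<theta> c v by (intro powr_mono2 sum_nonneg mult_nonneg_nonneg) (auto simp: less_imp_le)
    then show ?thesis using w by (simp add: V_def)
  qed
qed

lemma weight_bound_infinity_sum:
  assumes "weight_bound \<infinity> \<delta> J \<theta> s b" and "\<And>j. j \<in> J \<Longrightarrow> cmod (g j) \<le> K * \<delta> j" and "0 \<le> K"
  shows "cmod (\<Sum>j\<in>J. b j * g j) \<le> K * exp (- s)"
proof -
  have "cmod (\<Sum>j\<in>J. b j * g j) \<le> (\<Sum>j\<in>J. cmod (b j) * (K * \<delta> j))"
    using assms(2) by (intro sum_norm_le) (auto simp: norm_mult intro!: mult_left_mono)
  also have "\<dots> = K * (\<Sum>j\<in>J. cmod (b j) * \<delta> j)"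
    by (simp add: sum_distrib_left mult_ac)
  also have "\<dots> \<le> K * exp (- s)"
    using assms by (intro mult_left_mono) (auto simp: weight_bound_def)
  finally show ?thesis .
qed

text \<open>A pointwise form of the norm estimate for finite \<open>p\<close>: the right-hand side
  combines the normalised powers \<open>(cmod (g j) / \<delta> j) powr r\<close> linearly, so it can
  be integrated term by term.\<close>

lemma weight_bound_powr_sum:
  assumes p: "1 \<le> p" "p \<noteq> \<infinity>" and wb: "weight_bound p \<delta> J \<theta> s b"
    and "finite J" and \<theta>: "\<And>j. j \<in> J \<Longrightarrow> 0 < \<theta> j" and \<delta>: "\<And>j. j \<in> J \<Longrightarrow> 0 < \<delta> j"
  defines "r \<equiv> enn2real p"
  shows "cmod (\<Sum>j\<in>J. b j * g j) powr r \<le> exp (- s) powr r * (\<Sum>j\<in>J. \<theta> j * (cmod (g j) / \<delta> j) powr r)"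
proof -
  have r: "1 \<le> r" using one_le_enn2real[OF p] by (simp add: r_def)
  \<comment> \<open>The weights are rescaled so that \<open>weight_bound\<close> becomes
    \<open>c j \<le> 1\<close> for \<open>p = 1\<close> and the dual condition
    \<open>(\<Sum>j\<in>J. \<theta> j * c j powr q) \<le> 1\<close> of Hoelder's inequality for
    \<open>1 < p < \<infinity>\<close>.\<close>
  define c where "c j = \<delta> j * cmod (b j) * exp s / \<theta> j" for j
  define v where "v j = cmod (g j) / \<delta> j" for j
  have c0: "0 \<le> c j" and v0: "0 \<le> v j" if "j \<in> J" for j
    using \<theta>[OF that] \<delta>[OF that] by (auto simp: c_def v_def)
  have "cmod (\<Sum>j\<in>J. b j * g j) \<le> (\<Sum>j\<in>J. cmod (b j) * cmod (g j))"
    by (intro sum_norm_le) (auto simp: norm_mult)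
  also have "\<dots> = (\<Sum>j\<in>J. exp (- s) * (\<theta> j * c j * v j))"
  proof (rule sum.cong)
    fix j assume j: "j \<in> J"
    show "cmod (b j) * cmod (g j) = exp (- s) * (\<theta> j * c j * v j)"
      using \<theta>[OF j] \<delta>[OF j] by (simp add: c_def v_def exp_minus)
  qed simp
  also have "\<dots> = exp (- s) * (\<Sum>j\<in>J. \<theta> j * c j * v j)" by (simp add: sum_distrib_left)
  finally have "cmod (\<Sum>j\<in>J. b j * g j) powr r \<le> (exp (- s) * (\<Sum>j\<in>J. \<theta> j * c j * v j)) powr r"
    using r by (intro powr_mono2) auto
  also have "\<dots> = exp (- s) powr r * (\<Sum>j\<in>J. \<theta> j * c j * v j) powr r"
    using \<theta> c0 v0 by (intro powr_mult)
  also have "\<dots> \<le> exp (- s) powr r * (\<Sum>j\<in>J. \<theta> j * v j powr r)"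
  proof (rule mult_left_mono)
    show "(\<Sum>j\<in>J. \<theta> j * c j * v j) powr r \<le> (\<Sum>j\<in>J. \<theta> j * v j powr r)"
    proof (cases "p = 1")
      case True
      have c1: "c j \<le> 1" if "j \<in> J" for j
      proof -
        have "\<delta> j * cmod (b j) / \<theta> j \<le> (MAX j\<in>J. \<delta> j * cmod (b j) / \<theta> j)"
          using \<open>finite J\<close> that by (intro Max_ge) auto
        also have "\<dots> \<le> exp (- s)" using wb True by (simp add: weight_bound_def)
        finally have "\<delta> j * cmod (b j) / \<theta> j * exp s \<le> exp (- s) * exp s" by (rule mult_right_mono) simp
        then show ?thesis by (simp add: c_def flip: exp_add)
      qed
      have "(\<Sum>j\<in>J. \<theta> j * c j * v j) \<le> (\<Sum>j\<in>J. \<theta> j * v j)"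
        using \<theta> c1 c0 v0
        by (intro sum_mono mult_right_mono) (auto simp: mult_le_cancel_left1 less_imp_le not_less)
      moreover have "r = 1" using True by (simp add: r_def)
      moreover have "0 \<le> (\<Sum>j\<in>J. \<theta> j * c j * v j)"
        using \<theta> c0 v0 by (intro sum_nonneg mult_nonneg_nonneg) (auto simp: less_imp_le)
      ultimately show ?thesis using v0 by simp
    next
      case False
      then have r1: "1 < r"
        using p unfolding r_def by (intro one_less_enn2real)
      define q where "q = conj_exponent r"
      have q: "1 / r + 1 / q = 1" using conj_exponent_iff[OF r1] q_def by blast
      \<comment> \<open>By this identity \<open>\<theta> j / \<theta> j powr q\<close> equals
        \<open>1 / \<theta> j powr (q / r)\<close>, the power of \<open>\<theta> j\<close> that
        occurs in \<open>weight_bound\<close>.\<close>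
      have qr: "q / r = q - 1" using q r1 unfolding q_def conj_exponent_def by (simp add: field_simps)
      have "(\<Sum>j\<in>J. \<theta> j * c j powr q) =
          exp (q * s) * (\<Sum>j\<in>J. \<delta> j powr q * cmod (b j) powr q / \<theta> j powr (q / r))"
        unfolding sum_distrib_left
      proof (rule sum.cong)
        fix j assume j: "j \<in> J"
        show "\<theta> j * c j powr q =
            exp (q * s) * (\<delta> j powr q * cmod (b j) powr q / \<theta> j powr (q / r))"
          unfolding qr using \<theta>[OF j] \<delta>[OF j]
          by (simp add: c_def powr_divide powr_mult powr_diff exp_powr_real mult_ac)
      qed simp
      also have "\<dots> \<le> exp (q * s) * exp (- q * s)"
        using wb p False
        by (intro mult_left_mono) (simp_all add: weight_bound_def Let_def flip: r_def q_def)
      finally have "(\<Sum>j\<in>J. \<theta> j * c j powr q) \<le> 1" by (simp flip: exp_add)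
      then show ?thesis
        using weighted_Holder_sum[of J \<theta> c v r q] \<open>finite J\<close> \<theta> c0 v0 r1 q by simp
    qed
  qed simp
  finally show ?thesis by (simp add: v_def)
qed

text \<open>The pointwise estimates are integrated; since the \<open>\<theta> j\<close> sum to 1,
  the bounds for the \<open>g j\<close> combine into a single one. The factor \<open>K\<close>
  allows two uses: \<open>K = 1\<close> bounds the recovery error, and a large \<open>K\<close>
  shows that a linear method maps into \<open>Lp p\<close>.\<close>

lemma lp_norm_weighted_sum_le:
  fixes a g :: "nat \<Rightarrow> 'a::euclidean_space \<Rightarrow> complex"
  assumes p: "1 \<le> p"
    and "finite J" and \<theta>: "\<And>j. j \<in> J \<Longrightarrow> 0 < \<theta> j" "(\<Sum>j\<in>J. \<theta> j) = 1"
    and \<delta>: "\<And>j. j \<in> J \<Longrightarrow> 0 < \<delta> j"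
    and [measurable]: "\<And>j. j \<in> J \<Longrightarrow> a j \<in> borel_measurable lebesgue"
      "\<And>j. j \<in> J \<Longrightarrow> g j \<in> borel_measurable lebesgue"
    and wb: "AE \<xi> in lebesgue. weight_bound p \<delta> J \<theta> s (\<lambda>j. a j \<xi>)"
    and "0 \<le> K" and g: "\<And>j. j \<in> J \<Longrightarrow> lp_norm p (g j) \<le> ennreal (K * \<delta> j)"
  shows "lp_norm p (\<lambda>\<xi>. \<Sum>j\<in>J. a j \<xi> * g j \<xi>) \<le> ennreal (K * exp (- s))"
proof (cases "p = \<infinity>")
  case True
  have "AE \<xi> in lebesgue. \<forall>j\<in>J. cmod (g j \<xi>) \<le> K * \<delta> j"
  proof (intro AE_finite_allI \<open>finite J\<close>)
    fix j assume j: "j \<in> J"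
    show "AE \<xi> in lebesgue. cmod (g j \<xi>) \<le> K * \<delta> j"
      using g[OF j] \<open>0 \<le> K\<close> \<delta>[OF j] j unfolding True
      by (subst (asm) lp_norm_infinity_le_iff) simp_all
  qed
  then have "AE \<xi> in lebesgue. cmod (\<Sum>j\<in>J. a j \<xi> * g j \<xi>) \<le> K * exp (- s)"
    using wb
  proof eventually_elim
    case (elim \<xi>)
    then show ?case using weight_bound_infinity_sum[of \<delta> J \<theta> s "\<lambda>j. a j \<xi>" "\<lambda>j. g j \<xi>" K] True \<open>0 \<le> K\<close>
      by simp
  qed
  then show ?thesis
    unfolding True using \<open>0 \<le> K\<close> by (subst lp_norm_infinity_le_iff) simp_all
next
  case False
  define r where "r = enn2real p"
  have r: "1 \<le> r" using one_le_enn2real[OF p False] by (simp add: r_def)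
  have "(\<integral>\<^sup>+ \<xi>. ennreal (cmod (\<Sum>j\<in>J. a j \<xi> * g j \<xi>) powr r) \<partial>lebesgue) \<le>
      (\<integral>\<^sup>+ \<xi>. (\<Sum>j\<in>J. ennreal (exp (- s) powr r * \<theta> j / \<delta> j powr r) * ennreal (cmod (g j \<xi>) powr r)) \<partial>lebesgue)"
  proof (rule nn_integral_mono_AE, use wb in eventually_elim)
    case (elim \<xi>)
    have "cmod (\<Sum>j\<in>J. a j \<xi> * g j \<xi>) powr r \<le>
        exp (- s) powr r * (\<Sum>j\<in>J. \<theta> j * (cmod (g j \<xi>) / \<delta> j) powr r)"
      unfolding r_def
      by (rule weight_bound_powr_sum) (use p False elim \<open>finite J\<close> \<theta> \<delta> in auto)
    also have "\<dots> = (\<Sum>j\<in>J. exp (- s) powr r * \<theta> j / \<delta> j powr r * cmod (g j \<xi>) powr r)"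
      using \<delta> by (simp add: sum_distrib_left powr_divide less_imp_le mult.assoc)
    finally have "ennreal (cmod (\<Sum>j\<in>J. a j \<xi> * g j \<xi>) powr r) \<le>
        ennreal (\<Sum>j\<in>J. exp (- s) powr r * \<theta> j / \<delta> j powr r * cmod (g j \<xi>) powr r)"
      by (rule ennreal_leI)
    also have "\<dots> = (\<Sum>j\<in>J. ennreal (exp (- s) powr r * \<theta> j / \<delta> j powr r * cmod (g j \<xi>) powr r))"
      using \<theta>(1) by (intro sum_ennreal[symmetric]) (auto simp: less_imp_le)
    also have "\<dots> = (\<Sum>j\<in>J. ennreal (exp (- s) powr r * \<theta> j / \<delta> j powr r) * ennreal (cmod (g j \<xi>) powr r))"
      using \<theta>(1) by (intro sum.cong ennreal_mult) (auto simp: less_imp_le)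
    finally show ?case .
  qed
  also have "\<dots> = (\<Sum>j\<in>J. ennreal (exp (- s) powr r * \<theta> j / \<delta> j powr r) *
      (\<integral>\<^sup>+ \<xi>. ennreal (cmod (g j \<xi>) powr r) \<partial>lebesgue))"
    by (simp add: nn_integral_sum nn_integral_cmult)
  also have "\<dots> \<le> (\<Sum>j\<in>J. ennreal (exp (- s) powr r * \<theta> j / \<delta> j powr r) * ennreal ((K * \<delta> j) powr r))"
    using g \<open>0 \<le> K\<close> \<delta> by (intro sum_mono mult_left_mono) (auto simp: r_def less_imp_le simp flip: lp_norm_le_iff[OF p False])
  also have "\<dots> = (\<Sum>j\<in>J. ennreal ((K * exp (- s)) powr r * \<theta> j))"
  proof (rule sum.cong)
    fix j assume j: "j \<in> J"
    show "ennreal (exp (- s) powr r * \<theta> j / \<delta> j powr r) * ennreal ((K * \<delta> j) powr r) =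
        ennreal ((K * exp (- s)) powr r * \<theta> j)"
      using \<theta>(1)[OF j] \<delta>[OF j] \<open>0 \<le> K\<close> by (simp add: powr_mult mult_ac flip: ennreal_mult')
  qed simp
  also have "\<dots> = ennreal ((K * exp (- s)) powr r)"
    using \<theta> by (subst sum_ennreal) (auto simp: less_imp_le simp flip: sum_distrib_left)
  finally show ?thesis
    unfolding r_def using \<open>0 \<le> K\<close> by (subst lp_norm_le_iff[OF p False]) simp_all
qed

subsection \<open>Existence of weights\<close>

text \<open>In the coordinates \<open>ln (cmod (\<phi> i \<xi>))\<close> a power becomes the
  exponential of a linear form. The hypothesis admits a zero of \<open>\<phi> i\<close> only where
  the exponent is 0; there the factor is 1 on both sides.\<close>

lemma cmod_multi_power_eq_exp:
  assumes "\<And>i. \<phi> i \<xi> = 0 \<Longrightarrow> \<beta> $ i = 0"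
  shows "cmod (multi_power \<omega> \<phi> \<beta> \<xi>) = exp (\<beta> \<bullet> (\<chi> i. ln (cmod (\<phi> i \<xi>))))"
proof -
  have "cmod (branch_power \<omega> (\<phi> i \<xi>) (\<beta> $ i)) = exp (\<beta> $ i * ln (cmod (\<phi> i \<xi>)))" for i
    using assms[of i] by (simp add: branch_power_def norm_mult powr_def)
  then show ?thesis
    by (simp add: multi_power_def inner_vec_def exp_sum flip: prod_norm)
qed

lemma multi_power_eq_0:
  assumes "\<phi> i \<xi> = 0" "\<beta> $ i \<noteq> 0"
  shows "multi_power \<omega> \<phi> \<beta> \<xi> = 0"
  unfolding multi_power_def by (rule prod_zero) (use assms in \<open>auto simp: branch_power_def\<close>)

lemma measurable_multi_power:
  fixes \<phi> :: "'k::finite \<Rightarrow> 'a::euclidean_space \<Rightarrow> complex"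
  assumes "arg_branch \<omega>" and "\<And>i. continuous_on UNIV (\<phi> i)"
  shows "multi_power \<omega> \<phi> \<beta> \<in> borel_measurable lebesgue"
proof -
  have [measurable]: "\<omega> \<in> borel_measurable borel" using assms(1) by (simp add: arg_branch_def)
  have [measurable]: "\<phi> i \<in> borel_measurable borel" for i
    using assms(2) by (rule borel_measurable_continuous_onI)
  have "multi_power \<omega> \<phi> \<beta> \<in> borel_measurable borel"
    unfolding multi_power_def[abs_def] branch_power_def cis_conv_exp by measurable
  then show ?thesis by (intro measurable_completion) simp
qed

text \<open>This is the weighted AM-GM inequality, that is, convexity of \<open>exp\<close> in
  logarithmic coordinates, with the numbers \<open>ln (1 / \<delta> j)\<close> absorbed into the
  exponents.\<close>

lemma cmod_multi_power_convex_combination_le: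
  fixes \<phi> :: "'k::finite \<Rightarrow> 'a \<Rightarrow> complex" and \<alpha> :: "nat \<Rightarrow> real ^ 'k"
  assumes J: "finite J" and \<theta>: "\<And>j. j \<in> J \<Longrightarrow> 0 < \<theta> j" "(\<Sum>j\<in>J. \<theta> j) = 1"
    and \<alpha>: "\<And>j i. j \<in> J \<Longrightarrow> 0 \<le> \<alpha> j $ i" and \<delta>: "\<And>j. j \<in> J \<Longrightarrow> 0 < \<delta> j"
    and \<beta>: "\<beta> = (\<Sum>j\<in>J. \<theta> j *\<^sub>R \<alpha> j)" and s: "s = (\<Sum>j\<in>J. \<theta> j * ln (1 / \<delta> j))"
  shows "cmod (multi_power \<omega> \<phi> \<beta> \<xi>) \<le> exp (- s) * (\<Sum>j\<in>J. \<theta> j / \<delta> j * cmod (multi_power \<omega> \<phi> (\<alpha> j) \<xi>))"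
proof (cases "\<exists>i. \<phi> i \<xi> = 0 \<and> \<beta> $ i \<noteq> 0")
  case True
  then have "multi_power \<omega> \<phi> \<beta> \<xi> = 0" using multi_power_eq_0 by metis
  moreover have "0 \<le> (\<Sum>j\<in>J. \<theta> j / \<delta> j * cmod (multi_power \<omega> \<phi> (\<alpha> j) \<xi>))"
    using \<theta> \<delta> by (intro sum_nonneg) (auto simp: less_imp_le)
  ultimately show ?thesis by simp
next
  case False
  define L where "L = (\<chi> i. ln (cmod (\<phi> i \<xi>)))"
  \<comment> \<open>A coordinate of \<beta> that is 0 is a sum of nonnegative terms with positive
    weights, so this coordinate vanishes in every \<open>\<alpha> j\<close>. Hence the exponential
    form is available for all the powers involved.\<close>
  have \<alpha>0: "\<alpha> j $ i = 0" if "\<phi> i \<xi> = 0" "j \<in> J" for i j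
  proof -
    have "(\<Sum>j\<in>J. \<theta> j * \<alpha> j $ i) = 0" using False that \<beta> by auto
    then have "\<theta> j * \<alpha> j $ i = 0"
      using J \<theta> \<alpha> that by (subst (asm) sum_nonneg_eq_0_iff) (auto simp: less_imp_le)
    then show ?thesis using \<theta>(1)[OF that(2)] by simp
  qed
  have "exp s * cmod (multi_power \<omega> \<phi> \<beta> \<xi>) = exp (s + \<beta> \<bullet> L)"
    using cmod_multi_power_eq_exp[of \<phi> \<xi> \<beta> \<omega>] False by (auto simp: L_def exp_add)
  also have "s + \<beta> \<bullet> L = (\<Sum>j\<in>J. \<theta> j *\<^sub>R (ln (1 / \<delta> j) + \<alpha> j \<bullet> L))"
    by (simp add: s \<beta> inner_sum_left distrib_left sum.distrib)
  also have "exp \<dots> \<le> (\<Sum>j\<in>J. \<theta> j * exp (ln (1 / \<delta> j) + \<alpha> j \<bullet> L))"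
    using J \<theta> by (intro convex_on_sum[OF _ _ exp_convex]) (auto simp: less_imp_le)
  also have "\<dots> = (\<Sum>j\<in>J. \<theta> j / \<delta> j * cmod (multi_power \<omega> \<phi> (\<alpha> j) \<xi>))"
  proof (rule sum.cong)
    fix j assume j: "j \<in> J"
    show "\<theta> j * exp (ln (1 / \<delta> j) + \<alpha> j \<bullet> L) = \<theta> j / \<delta> j * cmod (multi_power \<omega> \<phi> (\<alpha> j) \<xi>)"
      using cmod_multi_power_eq_exp[of \<phi> \<xi> "\<alpha> j" \<omega>] \<alpha>0 j \<delta>[OF j] by (simp add: L_def exp_add)
  qed simp
  finally show ?thesis by (simp add: exp_minus field_simps)
qed

text \<open>One bound, linear in \<open>\<theta> j\<close>, serves all three forms of the condition.
  Summing over \<open>J\<close> settles \<open>p = \<infinity>\<close> and dividing by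
  \<open>\<theta> j\<close> settles \<open>p = 1\<close>. Otherwise the power \<open>q\<close> of
  the bound, divided by \<open>\<theta> j powr (q / r)\<close>, is
  \<open>\<theta> j * exp (- q * s)\<close>, and these add up to
  \<open>exp (- q * s)\<close>.\<close>

lemma weight_boundI:
  assumes p: "1 \<le> p" and J: "finite J"
    and \<theta>: "\<And>j. j \<in> J \<Longrightarrow> 0 < \<theta> j" "(\<Sum>j\<in>J. \<theta> j) = 1" and \<delta>: "\<And>j. j \<in> J \<Longrightarrow> 0 < \<delta> j"
    and b: "\<And>j. j \<in> J \<Longrightarrow> \<delta> j * cmod (b j) \<le> \<theta> j * exp (- s)"
  shows "weight_bound p \<delta> J \<theta> s b"
proof -
  have "(\<Sum>j\<in>J. cmod (b j) * \<delta> j) \<le> exp (- s)"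
  proof -
    have "(\<Sum>j\<in>J. cmod (b j) * \<delta> j) \<le> (\<Sum>j\<in>J. \<theta> j * exp (- s))"
      using b by (intro sum_mono) (simp add: mult.commute)
    then show ?thesis using \<theta> by (simp flip: sum_distrib_right)
  qed
  moreover have "(MAX j\<in>J. \<delta> j * cmod (b j) / \<theta> j) \<le> exp (- s)"
  proof -
    \<comment> \<open>A maximum over \<open>J\<close> is meaningful only for nonempty
      \<open>J\<close>, which holds because the weights sum to 1.\<close>
    have "J \<noteq> {}" using \<theta> by auto
    then show ?thesis using J b \<theta> by (auto simp: field_simps)
  qed
  moreover have "(\<Sum>j\<in>J. \<delta> j powr q * cmod (b j) powr q / \<theta> j powr (q / r)) \<le> exp (- q * s)"
    if "p \<noteq> \<infinity>" "p \<noteq> 1" "r = enn2real p" "q = conj_exponent r" for r q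
  proof -
    have r: "1 < r"
      using p that by (simp add: one_less_enn2real)
    have q: "0 < q" "q / r = q - 1"
      using r unfolding that(4) conj_exponent_def by (simp_all add: field_simps)
    have "(\<Sum>j\<in>J. \<delta> j powr q * cmod (b j) powr q / \<theta> j powr (q / r)) \<le> (\<Sum>j\<in>J. \<theta> j * exp (- q * s))"
    proof (rule sum_mono)
      fix j assume j: "j \<in> J"
      have "\<delta> j powr q * cmod (b j) powr q = (\<delta> j * cmod (b j)) powr q"
        using \<delta>[OF j] by (simp add: powr_mult)
      also have "\<dots> \<le> (\<theta> j * exp (- s)) powr q"
        using b[OF j] \<delta>[OF j] q by (intro powr_mono2) auto
      also have "\<dots> = \<theta> j * exp (- q * s) * \<theta> j powr (q / r)"
        using \<theta>(1)[OF j] by (simp add: powr_mult exp_powr_real q powr_diff mult_ac)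
      finally show "\<delta> j powr q * cmod (b j) powr q / \<theta> j powr (q / r) \<le> \<theta> j * exp (- q * s)"
        using \<theta>(1)[OF j] by (simp add: divide_le_eq)
    qed
    then show ?thesis using \<theta> by (simp flip: sum_distrib_right)
  qed
  ultimately show ?thesis unfolding weight_bound_def Let_def by auto
qed

text \<open>The weights are explicit. \<open>D\<close> is the AM-GM majorant without its constant
  \<open>exp (- s)\<close>, so the ratio \<open>c\<close> of the power with exponent \<beta> to
  \<open>D\<close> has modulus at most \<open>exp (- s)\<close>; the summands of \<open>D\<close>
  are scaled by this ratio.\<close>

lemma ex_recovery_weights:
  fixes \<phi> :: "'k::finite \<Rightarrow> 'a::euclidean_space \<Rightarrow> complex" and \<alpha> :: "nat \<Rightarrow> real ^ 'k"
  assumes p: "1 \<le> p" and \<omega>: "arg_branch \<omega>" and \<phi>: "\<And>i. continuous_on UNIV (\<phi> i)"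
    and J: "finite J" and \<theta>: "\<And>j. j \<in> J \<Longrightarrow> 0 < \<theta> j" "(\<Sum>j\<in>J. \<theta> j) = 1"
    and \<alpha>: "\<And>j i. j \<in> J \<Longrightarrow> 0 \<le> \<alpha> j $ i" and \<delta>: "\<And>j. j \<in> J \<Longrightarrow> 0 < \<delta> j"
    and \<beta>: "\<beta> = (\<Sum>j\<in>J. \<theta> j *\<^sub>R \<alpha> j)" and s: "s = (\<Sum>j\<in>J. \<theta> j * ln (1 / \<delta> j))"
  obtains a where "\<And>j. a j \<in> borel_measurable lebesgue"
    and "\<And>\<xi>. (\<Sum>j\<in>J. multi_power \<omega> \<phi> (\<alpha> j) \<xi> * a j \<xi>) = multi_power \<omega> \<phi> \<beta> \<xi>"
    and "\<And>\<xi>. weight_bound p \<delta> J \<theta> s (\<lambda>j. a j \<xi>)"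
proof
  note [measurable] = measurable_multi_power[OF \<omega> \<phi>]
  define u where "u j = multi_power \<omega> \<phi> (\<alpha> j)" for j
  define D where "D \<xi> = (\<Sum>j\<in>J. \<theta> j / \<delta> j * cmod (u j \<xi>))" for \<xi>
  define c where "c \<xi> = multi_power \<omega> \<phi> \<beta> \<xi> / complex_of_real (D \<xi>)" for \<xi>
  \<comment> \<open>The factor \<open>cnj (sgn (u j \<xi>))\<close> cancels the phase of
    \<open>u j \<xi>\<close>, so the products \<open>u j \<xi> * a j \<xi>\<close> are nonnegative
    multiples of the same number \<open>c \<xi>\<close>, with coefficients adding up to
    \<open>D \<xi>\<close>.\<close>
  define a where "a j \<xi> = complex_of_real (\<theta> j / \<delta> j) * cnj (sgn (u j \<xi>)) * c \<xi>" for j \<xi>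
  have D0: "0 \<le> D \<xi>" for \<xi>
    unfolding D_def using \<theta> \<delta> by (intro sum_nonneg) (auto simp: less_imp_le)
  have le: "cmod (multi_power \<omega> \<phi> \<beta> \<xi>) \<le> exp (- s) * D \<xi>" for \<xi>
    unfolding D_def u_def by (rule cmod_multi_power_convex_combination_le) fact+
  have c: "cmod (c \<xi>) \<le> exp (- s)" for \<xi>
    using le[of \<xi>] D0[of \<xi>] by (auto simp: c_def norm_divide divide_le_eq)
  show "a j \<in> borel_measurable lebesgue" for j
  proof -
    have u: "u j \<in> borel_measurable lebesgue" for j unfolding u_def by measurable
    have "D \<in> borel_measurable lebesgue" unfolding D_def using u by measurable
    then have "(\<lambda>\<xi>. complex_of_real (D \<xi>)) \<in> borel_measurable lebesgue"
      by (rule measurable_compose) (intro borel_measurable_continuous_onI continuous_intros)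
    then have "c \<in> borel_measurable lebesgue"
      unfolding c_def by (intro borel_measurable_divide measurable_multi_power \<omega> \<phi>)
    moreover have "(\<lambda>\<xi>. cnj (sgn (u j \<xi>))) \<in> borel_measurable lebesgue"
    proof (rule measurable_compose[where g = cnj])
      show "(\<lambda>\<xi>. sgn (u j \<xi>)) \<in> borel_measurable lebesgue"
        unfolding sgn_div_norm using u[of j] by measurable
      show "cnj \<in> borel_measurable borel"
        by (intro borel_measurable_continuous_onI continuous_intros)
    qed
    ultimately show ?thesis unfolding a_def by (intro borel_measurable_times borel_measurable_const)
  qed
  show "(\<Sum>j\<in>J. multi_power \<omega> \<phi> (\<alpha> j) \<xi> * a j \<xi>) = multi_power \<omega> \<phi> \<beta> \<xi>" for \<xi>
  proof -
    have "u j \<xi> * cnj (sgn (u j \<xi>)) = complex_of_real (cmod (u j \<xi>))" for j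
    proof -
      have "u j \<xi> * cnj (sgn (u j \<xi>)) = (u j \<xi> * cnj (u j \<xi>)) / complex_of_real (cmod (u j \<xi>))"
        by (simp add: sgn_eq)
      also have "\<dots> = complex_of_real (cmod (u j \<xi>))"
        unfolding complex_norm_square[symmetric] by (simp add: power2_eq_square)
      finally show ?thesis .
    qed
    then have "u j \<xi> * a j \<xi> = complex_of_real (\<theta> j / \<delta> j * cmod (u j \<xi>)) * c \<xi>" for j
      unfolding a_def by (metis (no_types, opaque_lifting) mult.assoc mult.left_commute of_real_mult)
    then have "(\<Sum>j\<in>J. u j \<xi> * a j \<xi>) = complex_of_real (D \<xi>) * c \<xi>"
      by (simp add: D_def sum_distrib_right)
    \<comment> \<open>If \<open>D \<xi> = 0\<close>, the AM-GM bound forces the power with exponent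
      \<beta> to vanish as well, which agrees with the value 0 of the division by zero.\<close>
    also have "\<dots> = multi_power \<omega> \<phi> \<beta> \<xi>"
      using le[of \<xi>] by (cases "D \<xi> = 0") (simp_all add: c_def)
    finally show ?thesis by (simp add: u_def)
  qed
  show "weight_bound p \<delta> J \<theta> s (\<lambda>j. a j \<xi>)" for \<xi>
  proof (rule weight_boundI)
    fix j assume j: "j \<in> J"
    have "\<delta> j * cmod (a j \<xi>) = \<theta> j * (cmod (sgn (u j \<xi>)) * cmod (c \<xi>))"
      using \<theta>(1)[OF j] \<delta>[OF j] by (simp add: a_def norm_mult norm_divide)
    also have "\<dots> \<le> \<theta> j * (1 * exp (- s))"
      using \<theta>(1)[OF j] c by (intro mult_left_mono mult_mono) (auto simp: norm_sgn)
    finally show "\<delta> j * cmod (a j \<xi>) \<le> \<theta> j * exp (- s)" by simp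
  qed (use p J \<theta> \<delta> in auto)
qed

subsection \<open>Upper bound\<close>

text \<open>The norms of the data are arbitrary here, so they are first compared with the numbers
  \<open>\<delta> j\<close> through a common factor \<open>K\<close>; the weight condition then
  bounds the sum. Passing to classes involves only finitely many null sets.\<close>

lemma recovery_method_linear:
  fixes a :: "nat \<Rightarrow> 'a::euclidean_space \<Rightarrow> complex"
  assumes p: "1 \<le> p" and J: "finite J"
    and \<theta>: "\<And>j. j \<in> J \<Longrightarrow> 0 < \<theta> j" "(\<Sum>j\<in>J. \<theta> j) = 1" and \<delta>: "\<And>j. j \<in> J \<Longrightarrow> 0 < \<delta> j"
    and a[measurable]: "\<And>j. j \<in> J \<Longrightarrow> a j \<in> borel_measurable lebesgue"
    and wb: "AE \<xi> in lebesgue. weight_bound p \<delta> J \<theta> s (\<lambda>j. a j \<xi>)"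
  shows "(\<lambda>y \<xi>. \<Sum>j\<in>J \<inter> {1..m}. a j \<xi> * y j \<xi>) \<in> recovery_methods p m"
  unfolding recovery_methods_def
proof (intro CollectI conjI ballI impI)
  fix y :: "nat \<Rightarrow> 'a \<Rightarrow> complex" assume y: "y \<in> {1..m} \<rightarrow> Lp p"
  \<comment> \<open>Extending the data by 0 to the indices of \<open>J\<close> beyond
    \<open>m\<close> turns the sum over \<open>J \<inter> {1..m}\<close> into one over
    \<open>J\<close>, to which the weight condition refers.\<close>
  define g where "g j = (if j \<in> {1..m} then y j else (\<lambda>_. 0))" for j
  have "\<exists>C. g j \<in> borel_measurable lebesgue \<and> 0 \<le> C \<and> lp_norm p (g j) \<le> ennreal C" for j
  proof (cases "j \<in> {1..m}")
    case True
    then show ?thesis using y by (metis LpE PiE g_def)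
  next
    case False
    then show ?thesis using lp_norm_0[OF p] by (intro exI[of _ 0]) (auto simp: g_def)
  qed
  then obtain C where C: "\<And>j. g j \<in> borel_measurable lebesgue" "\<And>j. 0 \<le> C j"
      "\<And>j. lp_norm p (g j) \<le> ennreal (C j)"
    by metis
  define K where "K = (\<Sum>j\<in>J. C j / \<delta> j)"
  have K0: "0 \<le> K" unfolding K_def using C(2) \<delta> by (intro sum_nonneg divide_nonneg_pos)
  have "C j \<le> K * \<delta> j" if "j \<in> J" for j
  proof -
    have "C j / \<delta> j \<le> K"
      unfolding K_def using C(2) \<delta> J that by (intro member_le_sum divide_nonneg_pos) auto
    then show ?thesis using \<delta>[OF that] by (simp add: divide_le_eq)
  qed
  then have "lp_norm p (g j) \<le> ennreal (K * \<delta> j)" if "j \<in> J" for j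
    using C(3)[of j] that by (meson ennreal_leI order_trans)
  then have "lp_norm p (\<lambda>\<xi>. \<Sum>j\<in>J. a j \<xi> * g j \<xi>) \<le> ennreal (K * exp (- s))"
    by (intro lp_norm_weighted_sum_le[of p J \<theta> \<delta>] p J \<theta> \<delta> a C K0 wb)
  then have "lp_norm p (\<lambda>\<xi>. \<Sum>j\<in>J. a j \<xi> * g j \<xi>) < \<infinity>"
    by (rule order_le_less_trans) simp
  moreover have "(\<lambda>\<xi>. \<Sum>j\<in>J. a j \<xi> * g j \<xi>) \<in> borel_measurable lebesgue"
    using C(1) a by measurable
  moreover have "(\<Sum>j\<in>J. a j \<xi> * g j \<xi>) = (\<Sum>j\<in>J \<inter> {1..m}. a j \<xi> * y j \<xi>)" for \<xi>
    using J by (simp add: sum.inter_restrict g_def) (rule sum.cong, auto)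
  ultimately show "(\<lambda>\<xi>. \<Sum>j\<in>J \<inter> {1..m}. a j \<xi> * y j \<xi>) \<in> Lp p"
    by (simp add: Lp_def)
next
  fix y y' :: "nat \<Rightarrow> 'a \<Rightarrow> complex"
  assume "\<forall>j\<in>{1..m}. AE \<xi> in lebesgue. y j \<xi> = y' j \<xi>"
  then have "AE \<xi> in lebesgue. \<forall>j\<in>{1..m}. y j \<xi> = y' j \<xi>" by (intro AE_finite_allI) auto
  then show "AE \<xi> in lebesgue. (\<Sum>j\<in>J \<inter> {1..m}. a j \<xi> * y j \<xi>) = (\<Sum>j\<in>J \<inter> {1..m}. a j \<xi> * y' j \<xi>)"
    by eventually_elim (auto intro: sum.cong)
qed

lemma recovery_error_le:
  fixes \<phi> :: "'k::finite \<Rightarrow> 'a::euclidean_space \<Rightarrow> complex" and \<alpha> :: "nat \<Rightarrow> real ^ 'k"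
  assumes p: "1 \<le> p" and \<omega>: "arg_branch \<omega>" and \<phi>: "\<And>i. continuous_on UNIV (\<phi> i)"
    and JN: "J \<subseteq> {1..N}"
    and \<theta>: "\<And>j. j \<in> J \<Longrightarrow> 0 < \<theta> j" "(\<Sum>j\<in>J. \<theta> j) = 1" and \<delta>: "\<And>j. j \<in> J \<Longrightarrow> 0 < \<delta> j"
    and a[measurable]: "\<And>j. j \<in> J \<Longrightarrow> a j \<in> borel_measurable lebesgue"
    and rep: "AE \<xi> in lebesgue.
      (\<Sum>j\<in>J. multi_power \<omega> \<phi> (\<alpha> j) \<xi> * a j \<xi>) = multi_power \<omega> \<phi> (\<alpha> 0) \<xi>"
    and wb: "AE \<xi> in lebesgue. weight_bound p \<delta> J \<theta> s (\<lambda>j. a j \<xi>)"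
  defines "\<Lambda> \<equiv> \<Lambda>_op \<omega> \<phi> \<alpha>"
  shows "recovery_error p \<Lambda> (W_class p \<Lambda> m N \<delta>) m \<delta> (\<lambda>y \<xi>. \<Sum>j\<in>J \<inter> {1..m}. a j \<xi> * y j \<xi>)
    \<le> ennreal (exp (- s))"
  unfolding recovery_error_def
proof (rule Sup_least, clarify)
  fix x y
  assume x: "x \<in> W_class p \<Lambda> m N \<delta>" and y: "y \<in> {1..m} \<rightarrow> Lp p"
    and xy: "\<forall>j\<in>{1..m}. lp_norm p (\<lambda>\<xi>. \<Lambda> j x \<xi> - y j \<xi>) \<le> ennreal (\<delta> j)"
  have J: "finite J" using JN finite_subset by blast
  note [measurable] = measurable_multi_power[OF \<omega> \<phi>]
  have [measurable]: "x \<in> borel_measurable lebesgue"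
    using x by (simp add: W_class_def W_space_def Lp_def)
  have [measurable]: "\<Lambda> j x \<in> borel_measurable lebesgue" for j
    unfolding \<Lambda>_def \<Lambda>_op_def by measurable
  have y_meas: "y j \<in> borel_measurable lebesgue" if "j \<in> {1..m}" for j
    using y that by (auto simp: Lp_def)
  then have [measurable]: "y j \<in> borel_measurable lebesgue" if "j \<in> J \<inter> {1..m}" for j
    using that by auto
  \<comment> \<open>For \<open>j \<in> J\<close> this is the observation error if
    \<open>j \<le> m\<close> and the unobserved \<open>\<Lambda> j x\<close> if
    \<open>j > m\<close>. Its norm is at most \<open>\<delta> j\<close> by the accuracy of the data
    or by the constraint in the class.\<close>
  define g where "g j = (if j \<in> {1..m} then (\<lambda>\<xi>. \<Lambda> j x \<xi> - y j \<xi>) else \<Lambda> j x)" for j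
  have g_meas: "g j \<in> borel_measurable lebesgue" for j
    using y_meas by (auto simp: g_def intro!: borel_measurable_diff)
  have g: "lp_norm p (g j) \<le> ennreal (1 * \<delta> j)" if "j \<in> J" for j
  proof (cases "j \<in> {1..m}")
    case True
    then show ?thesis using xy by (simp add: g_def)
  next
    case False
    then have "j \<in> {m+1..N}" using that JN by auto
    then show ?thesis using x False unfolding W_class_def g_def by auto
  qed
  have "lp_norm p (\<lambda>\<xi>. \<Lambda> 0 x \<xi> - (\<Sum>j\<in>J \<inter> {1..m}. a j \<xi> * y j \<xi>)) =
      lp_norm p (\<lambda>\<xi>. \<Sum>j\<in>J. a j \<xi> * g j \<xi>)"
  proof (rule lp_norm_AE_cong)
    show "(\<lambda>\<xi>. \<Sum>j\<in>J. a j \<xi> * g j \<xi>) \<in> borel_measurable lebesgue" using a g_meas by measurable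
    show "(\<lambda>\<xi>. \<Lambda> 0 x \<xi> - (\<Sum>j\<in>J \<inter> {1..m}. a j \<xi> * y j \<xi>)) \<in> borel_measurable lebesgue"
      by measurable
    show "AE \<xi> in lebesgue. \<Lambda> 0 x \<xi> - (\<Sum>j\<in>J \<inter> {1..m}. a j \<xi> * y j \<xi>) = (\<Sum>j\<in>J. a j \<xi> * g j \<xi>)"
      using rep
    proof eventually_elim
      case (elim \<xi>)
      have "(\<Sum>j\<in>J. a j \<xi> * g j \<xi>) =
          (\<Sum>j\<in>J. a j \<xi> * \<Lambda> j x \<xi>) - (\<Sum>j\<in>J. if j \<in> {1..m} then a j \<xi> * y j \<xi> else 0)"
        unfolding sum_subtractf[symmetric] by (rule sum.cong) (auto simp: g_def algebra_simps)
      \<comment> \<open>Here the representation of the power with exponent \<open>\<alpha> 0\<close>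
        enters: it expresses \<open>\<Lambda> 0 x\<close> through all \<open>\<Lambda> j x\<close>
        with \<open>j \<in> J\<close>, observed or not.\<close>
      moreover have "(\<Sum>j\<in>J. a j \<xi> * \<Lambda> j x \<xi>) = \<Lambda> 0 x \<xi>"
        unfolding \<Lambda>_def \<Lambda>_op_def elim[symmetric] by (simp add: sum_distrib_left mult_ac)
      ultimately show ?case using J by (simp add: sum.inter_restrict)
    qed
  qed
  also have "\<dots> \<le> ennreal (1 * exp (- s))"
    by (intro lp_norm_weighted_sum_le[of p J \<theta> \<delta>] p J \<theta> \<delta> a g_meas g wb) simp_all
  finally show "lp_norm p (\<lambda>\<xi>. \<Lambda> 0 x \<xi> - (\<Sum>j\<in>J \<inter> {1..m}. a j \<xi> * y j \<xi>)) \<le> ennreal (exp (- s))"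
    by simp
qed

subsection \<open>Lower bound\<close>

text \<open>The function \<open>h\<close> is the indicator of the ball, normalised to norm 1, so the
  norm of \<open>f * h\<close> lies between the infimum and the supremum of \<open>cmod f\<close>
  over the ball. This form hides the distinction between finite and infinite \<open>p\<close> from
  the later argument.\<close>

lemma ex_localised_Lp_function:
  fixes z :: "'a::euclidean_space"
  assumes p: "1 \<le> p" and e: "0 < e"
  shows "\<exists>h :: 'a \<Rightarrow> complex. h \<in> borel_measurable lebesgue \<and>
    (\<forall>f C. f \<in> borel_measurable lebesgue \<longrightarrow> 0 \<le> C \<longrightarrow> (\<forall>\<xi>\<in>ball z e. cmod (f \<xi>) \<le> C) \<longrightarrow>
      lp_norm p (\<lambda>\<xi>. f \<xi> * h \<xi>) \<le> ennreal C) \<and>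
    (\<forall>f B C. f \<in> borel_measurable lebesgue \<longrightarrow> 0 \<le> B \<longrightarrow> 0 \<le> C \<longrightarrow>
      lp_norm p (\<lambda>\<xi>. f \<xi> * h \<xi>) \<le> ennreal C \<longrightarrow> (\<forall>\<xi>\<in>ball z e. B \<le> cmod (f \<xi>)) \<longrightarrow> B \<le> C)"
proof (cases "p = \<infinity>")
  case True
  have [measurable]: "ball z e \<in> sets lebesgue" by simp
  define h :: "'a \<Rightarrow> complex" where "h \<xi> = indicator (ball z e) \<xi>" for \<xi>
  have h[measurable]: "h \<in> borel_measurable lebesgue" unfolding h_def by measurable
  show ?thesis
  proof (intro exI[of _ h] conjI allI impI h)
    fix f :: "'a \<Rightarrow> complex" and C :: real
    assume [measurable]: "f \<in> borel_measurable lebesgue" and "0 \<le> C"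
      and "\<forall>\<xi>\<in>ball z e. cmod (f \<xi>) \<le> C"
    moreover have "(\<lambda>\<xi>. f \<xi> * h \<xi>) \<in> borel_measurable lebesgue" by measurable
    ultimately show "lp_norm p (\<lambda>\<xi>. f \<xi> * h \<xi>) \<le> ennreal C"
      unfolding True by (subst lp_norm_infinity_le_iff) (auto simp: h_def indicator_def)
  next
    fix f :: "'a \<Rightarrow> complex" and C B :: real
    assume [measurable]: "f \<in> borel_measurable lebesgue" and C: "0 \<le> C"
      and le: "lp_norm p (\<lambda>\<xi>. f \<xi> * h \<xi>) \<le> ennreal C"
      and B: "\<forall>\<xi>\<in>ball z e. B \<le> cmod (f \<xi>)"
    have AE: "AE \<xi> in lebesgue. cmod (f \<xi> * h \<xi>) \<le> C"
      using le C unfolding True by (subst (asm) lp_norm_infinity_le_iff) simp_all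
    show "B \<le> C"
    \<comment> \<open>If \<open>C < B\<close>, then \<open>f * h\<close> exceeds \<open>C\<close> in
      modulus on the whole ball, which would be negligible; a nonempty open set is not.\<close>
    proof (rule ccontr)
      assume "\<not> B \<le> C"
      have "AE \<xi> in lebesgue. \<xi> \<notin> ball z e"
        using AE
      proof eventually_elim
        case (elim \<xi>)
        then show ?case using B[rule_format, of \<xi>] \<open>\<not> B \<le> C\<close> by (auto simp: h_def)
      qed
      then have "ball z e \<in> null_sets lebesgue" by (subst AE_iff_null_sets) auto
      then have "negligible (ball z e)" by (simp add: negligible_iff_null_sets)
      then show False using open_not_negligible[of "ball z e"] e by simp
    qed
  qed
next
  case False
  have [measurable]: "ball z e \<in> sets lebesgue" by simp
  define r where "r = enn2real p"
  have r: "1 \<le> r" using one_le_enn2real[OF p False] by (simp add: r_def)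
  define v where "v = measure lebesgue (ball z e)"
  have v: "0 < v" unfolding v_def using e by (simp add: content_ball_pos)
  have ev: "emeasure lebesgue (ball z e) = ennreal v"
    unfolding v_def using emeasure_lborel_ball_finite[of z e]
    by (intro emeasure_eq_ennreal_measure) (simp add: less_top)
  \<comment> \<open>The constant is chosen so that \<open>t powr r\<close> times the volume of the
    ball is 1.\<close>
  define t where "t = (1 / v) powr (1 / r)"
  have t: "t powr r = 1 / v" "0 < t" using v r by (auto simp: t_def powr_powr)
  define h :: "'a \<Rightarrow> complex" where "h \<xi> = complex_of_real t * indicator (ball z e) \<xi>" for \<xi>
  have h[measurable]: "h \<in> borel_measurable lebesgue" unfolding h_def by measurable
  have fh: "cmod (f \<xi> * h \<xi>) powr r = cmod (f \<xi>) powr r * (1 / v) * indicator (ball z e) \<xi>" for f \<xi>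
    using t by (auto simp: h_def norm_mult powr_mult indicator_def)
  have const: "(\<integral>\<^sup>+ \<xi>. ennreal (B powr r * (1 / v) * indicator (ball z e) \<xi>) \<partial>lebesgue) = ennreal (B powr r)" for B
  proof -
    have "(\<integral>\<^sup>+ \<xi>. ennreal (B powr r * (1 / v) * indicator (ball z e) \<xi>) \<partial>lebesgue) =
        (\<integral>\<^sup>+ \<xi>. ennreal (B powr r / v) * indicator (ball z e) \<xi> \<partial>lebesgue)"
      by (intro nn_integral_cong) (auto simp: indicator_def)
    also have "\<dots> = ennreal (B powr r / v) * ennreal v"
      by (subst nn_integral_cmult_indicator) (auto simp: ev)
    also have "\<dots> = ennreal (B powr r)" using v by (simp flip: ennreal_mult')
    finally show ?thesis .
  qed
  show ?thesis
  proof (intro exI[of _ h] conjI allI impI h)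
    fix f :: "'a \<Rightarrow> complex" and C :: real
    assume "0 \<le> C" and C: "\<forall>\<xi>\<in>ball z e. cmod (f \<xi>) \<le> C"
    have "(\<integral>\<^sup>+ \<xi>. ennreal (cmod (f \<xi> * h \<xi>) powr r) \<partial>lebesgue) \<le>
        (\<integral>\<^sup>+ \<xi>. ennreal (C powr r * (1 / v) * indicator (ball z e) \<xi>) \<partial>lebesgue)"
      unfolding fh using C v r
      by (intro nn_integral_mono ennreal_leI) (auto simp: indicator_def intro!: powr_mono2 divide_right_mono)
    then show "lp_norm p (\<lambda>\<xi>. f \<xi> * h \<xi>) \<le> ennreal C"
      unfolding const using p False \<open>0 \<le> C\<close> by (subst lp_norm_le_iff) (simp_all flip: r_def)
  next
    fix f :: "'a \<Rightarrow> complex" and C B :: real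
    assume C: "0 \<le> C" and B: "0 \<le> B"
      and le: "lp_norm p (\<lambda>\<xi>. f \<xi> * h \<xi>) \<le> ennreal C"
      and fB: "\<forall>\<xi>\<in>ball z e. B \<le> cmod (f \<xi>)"
    have "ennreal (B powr r) = (\<integral>\<^sup>+ \<xi>. ennreal (B powr r * (1 / v) * indicator (ball z e) \<xi>) \<partial>lebesgue)"
      by (rule const[symmetric])
    also have "\<dots> \<le> (\<integral>\<^sup>+ \<xi>. ennreal (cmod (f \<xi> * h \<xi>) powr r) \<partial>lebesgue)"
      unfolding fh using fB v r B
      by (intro nn_integral_mono ennreal_leI) (auto simp: indicator_def intro!: powr_mono2 divide_right_mono)
    also have "\<dots> \<le> ennreal (C powr r)"
      using le C p False by (subst (asm) lp_norm_le_iff) (simp_all flip: r_def)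
    finally have "B powr r \<le> C powr r" by simp
    then show "B \<le> C" using C r by (smt (verit) powr_less_mono2)
  qed
qed

text \<open>\<open>u\<close> is half the difference of \<open>u - v\<close> and
  \<open>- u - v\<close>. Midpoint convexity of the power \<open>r\<close> turns this into a bound
  on the integral, so the argument avoids Minkowski's inequality.\<close>

lemma lp_norm_le_of_shifts:
  fixes u v :: "'a::euclidean_space \<Rightarrow> complex"
  assumes p: "1 \<le> p" and [measurable]: "u \<in> borel_measurable lebesgue" "v \<in> borel_measurable lebesgue"
    and "0 \<le> C"
    and 1: "lp_norm p (\<lambda>\<xi>. u \<xi> - v \<xi>) \<le> ennreal C"
    and 2: "lp_norm p (\<lambda>\<xi>. - u \<xi> - v \<xi>) \<le> ennreal C"
  shows "lp_norm p u \<le> ennreal C"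
proof -
  have tri: "cmod (u \<xi>) \<le> 1 / 2 * cmod (u \<xi> - v \<xi>) + 1 / 2 * cmod (- u \<xi> - v \<xi>)" for \<xi>
  proof -
    have "cmod (2 * u \<xi>) \<le> cmod (u \<xi> - v \<xi>) + cmod (- u \<xi> - v \<xi>)"
      using norm_triangle_ineq4[of "u \<xi> - v \<xi>" "- u \<xi> - v \<xi>"] by simp
    then show ?thesis by (simp add: norm_mult)
  qed
  show ?thesis
  proof (cases "p = \<infinity>")
    case True
    have "AE \<xi> in lebesgue. cmod (u \<xi> - v \<xi>) \<le> C" "AE \<xi> in lebesgue. cmod (- u \<xi> - v \<xi>) \<le> C"
      using 1 2 \<open>0 \<le> C\<close> unfolding True by (subst (asm) (1 2) lp_norm_infinity_le_iff; simp)+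
    then have "AE \<xi> in lebesgue. cmod (u \<xi>) \<le> C"
    proof eventually_elim
      case (elim \<xi>)
      then show ?case using tri[of \<xi>] by linarith
    qed
    then show ?thesis using \<open>0 \<le> C\<close> unfolding True by (subst lp_norm_infinity_le_iff) simp_all
  next
    case False
    define r where "r = enn2real p"
    have r: "1 \<le> r" using one_le_enn2real[OF p False] by (simp add: r_def)
    have convex: "(1 / 2 * s + 1 / 2 * t) powr r \<le> 1 / 2 * s powr r + 1 / 2 * t powr r"
      if st: "0 \<le> s" "0 \<le> t" for s t :: real
    proof -
      have half: "(1 / 2 * w) powr r \<le> 1 / 2 * w powr r" if "0 \<le> w" for w :: real
      proof -
        have "(1 / 2 * w) powr r = (1 / 2) powr r * w powr r" by (rule powr_mult)
        also have "\<dots> \<le> 1 / 2 * w powr r"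
          using powr_le_one_le[of "1 / 2" r] r by (intro mult_right_mono) auto
        finally show ?thesis .
      qed
      \<comment> \<open>Convexity of the power function is applied to positive arguments; if one
        argument is 0, the claim reduces to \<open>(1 / 2) powr r \<le> 1 / 2\<close>.\<close>
      consider "s = 0" | "t = 0" | "0 < s" "0 < t" using st by (metis order_le_less)
      then show ?thesis
      proof cases
        case 1
        then show ?thesis using half[OF st(2)] r by simp
      next
        case 2
        then show ?thesis using half[OF st(1)] r by simp
      next
        case 3
        then show ?thesis
          using convex_onD[OF powr_convex[OF r], of "1 / 2" s t] by simp
      qed
    qed
    have "(\<integral>\<^sup>+ \<xi>. ennreal (cmod (u \<xi>) powr r) \<partial>lebesgue) \<le>
        (\<integral>\<^sup>+ \<xi>. ennreal (1 / 2) * ennreal (cmod (u \<xi> - v \<xi>) powr r) +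
          ennreal (1 / 2) * ennreal (cmod (- u \<xi> - v \<xi>) powr r) \<partial>lebesgue)"
    proof (rule nn_integral_mono)
      fix \<xi>
      have "cmod (u \<xi>) powr r \<le> (1 / 2 * cmod (u \<xi> - v \<xi>) + 1 / 2 * cmod (- u \<xi> - v \<xi>)) powr r"
        using tri r by (intro powr_mono2) auto
      also have "\<dots> \<le> 1 / 2 * cmod (u \<xi> - v \<xi>) powr r + 1 / 2 * cmod (- u \<xi> - v \<xi>) powr r"
        by (rule convex) auto
      finally have "ennreal (cmod (u \<xi>) powr r) \<le>
          ennreal (1 / 2 * cmod (u \<xi> - v \<xi>) powr r + 1 / 2 * cmod (- u \<xi> - v \<xi>) powr r)"
        by (rule ennreal_leI)
      also have "\<dots> = ennreal (1 / 2 * cmod (u \<xi> - v \<xi>) powr r) + ennreal (1 / 2 * cmod (- u \<xi> - v \<xi>) powr r)"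
        by (intro ennreal_plus) auto
      also have "\<dots> = ennreal (1 / 2) * ennreal (cmod (u \<xi> - v \<xi>) powr r) +
          ennreal (1 / 2) * ennreal (cmod (- u \<xi> - v \<xi>) powr r)"
        by (intro arg_cong2[where f = "(+)"] ennreal_mult) auto
      finally show "ennreal (cmod (u \<xi>) powr r) \<le> ennreal (1 / 2) * ennreal (cmod (u \<xi> - v \<xi>) powr r) +
          ennreal (1 / 2) * ennreal (cmod (- u \<xi> - v \<xi>) powr r)" .
    qed
    also have "\<dots> = ennreal (1 / 2) * (\<integral>\<^sup>+ \<xi>. ennreal (cmod (u \<xi> - v \<xi>) powr r) \<partial>lebesgue) +
        ennreal (1 / 2) * (\<integral>\<^sup>+ \<xi>. ennreal (cmod (- u \<xi> - v \<xi>) powr r) \<partial>lebesgue)"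
      by (simp add: nn_integral_add nn_integral_cmult del: ennreal_half)
    also have "\<dots> \<le> ennreal (1 / 2) * ennreal (C powr r) + ennreal (1 / 2) * ennreal (C powr r)"
      using 1 2 \<open>0 \<le> C\<close> unfolding lp_norm_le_iff[OF p False \<open>0 \<le> C\<close>] r_def
      by (intro add_mono mult_left_mono) auto
    also have "\<dots> = ennreal (C powr r)"
      by (simp flip: ennreal_mult' ennreal_plus del: ennreal_half)
    finally show ?thesis
      unfolding lp_norm_le_iff[OF p False \<open>0 \<le> C\<close>] r_def .
  qed
qed

text \<open>The problem is centrally symmetric: \<open>x\<close> and its negative both admit the
  data 0, so \<open>\<Phi>\<close> has to approximate \<open>\<Lambda> 0 x\<close> and
  \<open>- \<Lambda> 0 x\<close> by one and the same function.\<close>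

lemma lp_norm_le_recovery_error:
  fixes x :: "'b::euclidean_space \<Rightarrow> complex"
  assumes p: "1 \<le> p" and "\<Phi> \<in> recovery_methods p m"
    and x: "x \<in> Lp p" "\<And>j. j \<le> N \<Longrightarrow> \<Lambda>_op \<omega> \<phi> \<alpha> j x \<in> Lp p"
    and \<delta>: "\<And>j. j \<in> {1..N} \<Longrightarrow> lp_norm p (\<Lambda>_op \<omega> \<phi> \<alpha> j x) \<le> ennreal (\<delta> j)" and "m \<le> N"
  defines "\<Lambda> \<equiv> \<Lambda>_op \<omega> \<phi> \<alpha>"
  shows "lp_norm p (\<Lambda> 0 x) \<le> recovery_error p \<Lambda> (W_class p \<Lambda> m N \<delta>) m \<delta> \<Phi>"
proof (cases "recovery_error p \<Lambda> (W_class p \<Lambda> m N \<delta>) m \<delta> \<Phi> = \<infinity>")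
  case False
  define C where "C = enn2real (recovery_error p \<Lambda> (W_class p \<Lambda> m N \<delta>) m \<delta> \<Phi>)"
  have C: "recovery_error p \<Lambda> (W_class p \<Lambda> m N \<delta>) m \<delta> \<Phi> = ennreal C"
    using False by (simp add: C_def less_top)
  define z :: "nat \<Rightarrow> 'b \<Rightarrow> complex" where "z = (\<lambda>_ _. 0)"
  have neg: "lp_norm p (\<lambda>\<xi>. - f \<xi>) = lp_norm p f" for f :: "'b \<Rightarrow> complex" by (simp add: lp_norm_def)
  have negL: "(\<lambda>\<xi>. - f \<xi>) \<in> Lp p" if "f \<in> Lp p" for f :: "'b \<Rightarrow> complex"
    using that neg[of f] by (auto simp: Lp_def)
  have \<Lambda>neg: "\<Lambda> j (\<lambda>\<xi>. - x \<xi>) = (\<lambda>\<xi>. - \<Lambda> j x \<xi>)" for j by (simp add: \<Lambda>_def \<Lambda>_op_def)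
  have zero: "(\<lambda>_. 0 :: complex) \<in> (Lp p :: ('b \<Rightarrow> complex) set)"
    using lp_norm_0[OF p, where 'a = 'b] by (simp add: Lp_def)
  have le: "lp_norm p (\<lambda>\<xi>. \<Lambda> 0 w \<xi> - \<Phi> z \<xi>) \<le> ennreal C"
    if "w = x \<or> w = (\<lambda>\<xi>. - x \<xi>)" for w
  proof -
    have "w \<in> W_class p \<Lambda> m N \<delta>"
      using that x \<delta> neg negL unfolding W_class_def W_space_def \<Lambda>_def[symmetric] by (auto simp: \<Lambda>neg)
    moreover have "lp_norm p (\<lambda>\<xi>. \<Lambda> j w \<xi> - z j \<xi>) \<le> ennreal (\<delta> j)" if "j \<in> {1..m}" for j
      using \<open>w = x \<or> _\<close> that \<delta>[of j] \<open>m \<le> N\<close> neg by (auto simp: z_def \<Lambda>neg simp flip: \<Lambda>_def)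
    moreover have "z \<in> {1..m} \<rightarrow> Lp p" using zero by (simp add: z_def)
    ultimately show ?thesis
      unfolding C[symmetric] recovery_error_def by (intro Sup_upper) blast
  qed
  have "\<Phi> z \<in> Lp p"
    using assms(2) zero unfolding recovery_methods_def z_def by auto
  then have "\<Phi> z \<in> borel_measurable lebesgue" by (simp add: Lp_def)
  moreover have "\<Lambda> 0 x \<in> borel_measurable lebesgue"
    using x(2)[of 0] by (simp add: Lp_def \<Lambda>_def)
  moreover have "lp_norm p (\<lambda>\<xi>. - \<Lambda> 0 x \<xi> - \<Phi> z \<xi>) \<le> ennreal C"
    using le[of "\<lambda>\<xi>. - x \<xi>"] by (simp add: \<Lambda>neg)
  ultimately have "lp_norm p (\<Lambda> 0 x) \<le> ennreal C"
    using lp_norm_le_of_shifts[OF p, of "\<Lambda> 0 x" "\<Phi> z" C] le[of x] by (simp add: C_def)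
  then show ?thesis using C by simp
qed simp

text \<open>Near \<open>z\<close> the power with exponent \<open>\<alpha> j\<close> has modulus
  close to \<open>exp (- (\<alpha> j \<bullet> \<eta>))\<close>. A function concentrated there and
  scaled by nearly \<open>exp (- c)\<close> meets every constraint, because the hyperplane lies
  above the points \<open>(\<alpha> j, ln (1 / \<delta> j))\<close>; its image under
  \<open>\<Lambda> 0\<close> reflects the height of the hyperplane at
  \<open>\<alpha> 0\<close>.\<close>

lemma recovery_error_ge_of_majorant:
  fixes \<phi> :: "'k::finite \<Rightarrow> 'a::euclidean_space \<Rightarrow> complex" and \<alpha> :: "nat \<Rightarrow> real ^ 'k"
  assumes p: "1 \<le> p" and \<omega>: "arg_branch \<omega>" and \<phi>: "\<And>i. continuous_on UNIV (\<phi> i)"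
    and "m \<le> N" and \<delta>: "\<And>j. j \<in> {1..N} \<Longrightarrow> 0 < \<delta> j"
    and maj: "\<And>j. j \<in> {1..N} \<Longrightarrow> ln (1 / \<delta> j) \<le> \<alpha> j \<bullet> \<eta> + c"
    and z: "\<And>i. cmod (\<phi> i z) = exp (- \<eta> $ i)" and \<epsilon>: "0 < \<epsilon>"
    and \<Phi>: "\<Phi> \<in> recovery_methods p m"
  defines "\<Lambda> \<equiv> \<Lambda>_op \<omega> \<phi> \<alpha>"
  shows "ennreal (exp (- (\<alpha> 0 \<bullet> \<eta> + c) - 2 * \<epsilon>)) \<le> recovery_error p \<Lambda> (W_class p \<Lambda> m N \<delta>) m \<delta> \<Phi>"
proof -
  note mp[measurable] = measurable_multi_power[OF \<omega> \<phi>]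
  define L where "L \<xi> = (\<chi> i. ln (cmod (\<phi> i \<xi>)))" for \<xi>
  have nz: "\<phi> i z \<noteq> 0" for i using z[of i] by auto
  have \<phi>lim: "(\<phi> i \<longlongrightarrow> \<phi> i z) (nhds z)" for i
    using \<phi>[of i] by (simp add: continuous_on_eq_continuous_at isCont_def tendsto_at_iff_tendsto_nhds)
  have "L z = - \<eta>" by (simp add: L_def z vec_eq_iff)
  have lim: "((\<lambda>\<xi>. \<beta> \<bullet> L \<xi>) \<longlongrightarrow> - (\<beta> \<bullet> \<eta>)) (nhds z)" for \<beta>
  proof -
    have "((\<lambda>\<xi>. \<beta> \<bullet> L \<xi>) \<longlongrightarrow> \<beta> \<bullet> L z) (nhds z)"
      unfolding L_def using nz by (intro tendsto_intros \<phi>lim) auto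
    then show ?thesis by (simp add: \<open>L z = - \<eta>\<close>)
  qed
  have "\<forall>\<^sub>F \<xi> in nhds z. (\<forall>i. \<phi> i \<xi> \<noteq> 0) \<and> (\<forall>j\<in>{..N}. dist (\<alpha> j \<bullet> L \<xi>) (- (\<alpha> j \<bullet> \<eta>)) < \<epsilon>)"
    using \<epsilon> by (intro eventually_conj eventually_all_finite eventually_ball_finite ballI
        tendsto_imp_eventually_ne[OF \<phi>lim nz] tendstoD[OF lim]) auto
  \<comment> \<open>The range \<open>{..N}\<close> includes the index 0, since the ball has to
    control the power to be recovered as well as those in the constraints.\<close>
  then obtain e where e: "0 < e" and
    ball: "\<And>\<xi>. \<xi> \<in> ball z e \<Longrightarrow> (\<forall>i. \<phi> i \<xi> \<noteq> 0) \<and> (\<forall>j\<in>{..N}. dist (\<alpha> j \<bullet> L \<xi>) (- (\<alpha> j \<bullet> \<eta>)) < \<epsilon>)"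
    unfolding eventually_nhds_metric by (auto simp: dist_commute)
  have near: "cmod (multi_power \<omega> \<phi> (\<alpha> j) \<xi>) \<le> exp (- (\<alpha> j \<bullet> \<eta>) + \<epsilon>)"
    "exp (- (\<alpha> j \<bullet> \<eta>) - \<epsilon>) \<le> cmod (multi_power \<omega> \<phi> (\<alpha> j) \<xi>)"
    if "\<xi> \<in> ball z e" "j \<le> N" for \<xi> j
  proof -
    have "cmod (multi_power \<omega> \<phi> (\<alpha> j) \<xi>) = exp (\<alpha> j \<bullet> L \<xi>)"
      unfolding L_def using ball[OF that(1)] by (intro cmod_multi_power_eq_exp) auto
    moreover have "\<bar>\<alpha> j \<bullet> L \<xi> + \<alpha> j \<bullet> \<eta>\<bar> < \<epsilon>"
      using ball[OF that(1)] that(2) by (auto simp: dist_real_def)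
    ultimately show "cmod (multi_power \<omega> \<phi> (\<alpha> j) \<xi>) \<le> exp (- (\<alpha> j \<bullet> \<eta>) + \<epsilon>)"
      "exp (- (\<alpha> j \<bullet> \<eta>) - \<epsilon>) \<le> cmod (multi_power \<omega> \<phi> (\<alpha> j) \<xi>)"
      by (simp_all add: abs_less_iff)
  qed
  obtain h :: "'a \<Rightarrow> complex" where h[measurable]: "h \<in> borel_measurable lebesgue"
    and up: "\<forall>f C. f \<in> borel_measurable lebesgue \<longrightarrow> 0 \<le> C \<longrightarrow> (\<forall>\<xi>\<in>ball z e. cmod (f \<xi>) \<le> C) \<longrightarrow>
      lp_norm p (\<lambda>\<xi>. f \<xi> * h \<xi>) \<le> ennreal C"
    and low: "\<forall>f B C. f \<in> borel_measurable lebesgue \<longrightarrow> 0 \<le> B \<longrightarrow> 0 \<le> C \<longrightarrow>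
      lp_norm p (\<lambda>\<xi>. f \<xi> * h \<xi>) \<le> ennreal C \<longrightarrow> (\<forall>\<xi>\<in>ball z e. B \<le> cmod (f \<xi>)) \<longrightarrow> B \<le> C"
    using ex_localised_Lp_function[OF p e, of z] by (elim exE conjE) (rule that)
  \<comment> \<open>The factor \<open>exp (- c)\<close> accounts for the height of the hyperplane,
    and \<open>exp (- \<epsilon>)\<close> cancels the oscillation of the powers from above. From
    below the two losses add up, whence \<open>2 * \<epsilon>\<close> in the conclusion.\<close>
  define \<kappa> where "\<kappa> = exp (- c - \<epsilon>)"
  define x where "x = (\<lambda>\<xi>. complex_of_real \<kappa> * h \<xi>)"
  define f where "f j \<xi> = multi_power \<omega> \<phi> (\<alpha> j) \<xi> * complex_of_real \<kappa>" for j \<xi>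
  have f_meas: "f j \<in> borel_measurable lebesgue" for j unfolding f_def by measurable
  have \<Lambda>x: "\<Lambda> j x = (\<lambda>\<xi>. f j \<xi> * h \<xi>)" for j by (auto simp: \<Lambda>_def \<Lambda>_op_def x_def f_def)
  have cf: "cmod (f j \<xi>) = cmod (multi_power \<omega> \<phi> (\<alpha> j) \<xi>) * \<kappa>" for j \<xi>
    by (simp add: f_def norm_mult \<kappa>_def)
  have up': "lp_norm p (\<Lambda> j x) \<le> ennreal (exp (- (\<alpha> j \<bullet> \<eta> + c)))" if "j \<le> N" for j
    unfolding \<Lambda>x
  proof (rule up[rule_format, OF f_meas])
    fix \<xi> assume \<xi>: "\<xi> \<in> ball z e"
    have "cmod (f j \<xi>) \<le> exp (- (\<alpha> j \<bullet> \<eta>) + \<epsilon>) * \<kappa>"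
      unfolding cf using near[OF \<xi> that] by (intro mult_right_mono) (auto simp: \<kappa>_def)
    then show "cmod (f j \<xi>) \<le> exp (- (\<alpha> j \<bullet> \<eta> + c))"
      by (simp add: \<kappa>_def flip: exp_add)
  qed simp
  have fin: "g \<in> Lp p" if "g \<in> borel_measurable lebesgue" "lp_norm p g \<le> ennreal C" for g :: "'a \<Rightarrow> complex" and C
    using that by (auto simp: Lp_def intro: order_le_less_trans)
  have main: "lp_norm p (\<Lambda> 0 x) \<le> recovery_error p \<Lambda> (W_class p \<Lambda> m N \<delta>) m \<delta> \<Phi>"
    unfolding \<Lambda>_def
  proof (rule lp_norm_le_recovery_error[OF p \<Phi> _ _ _ \<open>m \<le> N\<close>]; (unfold \<Lambda>_def[symmetric])?)
    have "lp_norm p (\<lambda>\<xi>. complex_of_real \<kappa> * h \<xi>) \<le> ennreal \<kappa>"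
      by (rule up[rule_format]) (auto simp: \<kappa>_def)
    then show "x \<in> Lp p" by (intro fin[of x \<kappa>]) (auto simp: x_def)
    show "\<Lambda> j x \<in> Lp p" if "j \<le> N" for j
      using up'[OF that] f_meas h by (intro fin) (auto simp: \<Lambda>x)
    show "lp_norm p (\<Lambda> j x) \<le> ennreal (\<delta> j)" if "j \<in> {1..N}" for j
    proof -
      have "exp (- (\<alpha> j \<bullet> \<eta> + c)) \<le> exp (- ln (1 / \<delta> j))" using maj[OF that] by simp
      also have "\<dots> = \<delta> j" using \<delta>[OF that] by (simp add: ln_div)
      finally show ?thesis using up'[of j] that by (meson atLeastAtMost_iff ennreal_leI order_trans)
    qed
  qed
  show ?thesis
  proof (cases "recovery_error p \<Lambda> (W_class p \<Lambda> m N \<delta>) m \<delta> \<Phi>")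
    case (real C)
    have "exp (- (\<alpha> 0 \<bullet> \<eta> + c) - 2 * \<epsilon>) \<le> C"
    proof (rule low[rule_format, OF f_meas[of 0]])
      show "lp_norm p (\<lambda>\<xi>. f 0 \<xi> * h \<xi>) \<le> ennreal C" using main real by (simp add: \<Lambda>x)
      fix \<xi> assume \<xi>: "\<xi> \<in> ball z e"
      have "exp (- (\<alpha> 0 \<bullet> \<eta> + c) - 2 * \<epsilon>) = exp (- (\<alpha> 0 \<bullet> \<eta>) - \<epsilon>) * \<kappa>"
        by (simp add: \<kappa>_def flip: exp_add)
      also have "\<dots> \<le> cmod (f 0 \<xi>)"
        unfolding cf using near[OF \<xi>, of 0] by (intro mult_right_mono) (auto simp: \<kappa>_def)
      finally show "exp (- (\<alpha> 0 \<bullet> \<eta> + c) - 2 * \<epsilon>) \<le> cmod (f 0 \<xi>)" .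
    qed (use real in auto)
    then show ?thesis using real by (simp add: ennreal_leI)
  qed simp
qed

subsection \<open>The upper boundary of the hull\<close>

text \<open>Different indices may give the same point, whereas the weights of a convex combination
  belong to points. One index is chosen for each point of nonzero weight, which also makes all
  remaining weights positive.\<close>

lemma convex_hull_image_finite_weights:
  fixes f :: "'i \<Rightarrow> 'v::real_vector"
  assumes "finite I" and "y \<in> convex hull (f ` I)"
  obtains J \<theta> where "J \<subseteq> I" "\<And>j. j \<in> J \<Longrightarrow> 0 < \<theta> j" "(\<Sum>j\<in>J. \<theta> j) = 1" "y = (\<Sum>j\<in>J. \<theta> j *\<^sub>R f j)"
proof -
  define g where "g = inv_into I f"
  have g: "g z \<in> I \<and> f (g z) = z" if "z \<in> f ` I" for z
    using that unfolding g_def by (simp add: inv_into_into f_inv_into_f)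
  obtain u where u: "\<And>z. z \<in> f ` I \<Longrightarrow> 0 \<le> u z" "sum u (f ` I) = 1" "(\<Sum>z\<in>f ` I. u z *\<^sub>R z) = y"
    using assms by (subst (asm) convex_hull_finite) auto
  define J where "J = g ` {z \<in> f ` I. u z \<noteq> 0}"
  have inj: "inj_on g {z \<in> f ` I. u z \<noteq> 0}" using g by (metis (no_types, lifting) inj_onI mem_Collect_eq)
  have eq: "(\<Sum>j\<in>J. h (f j)) = (\<Sum>z\<in>{z \<in> f ` I. u z \<noteq> 0}. h z)" for h :: "'v \<Rightarrow> 'w::comm_monoid_add"
    unfolding J_def using g by (subst sum.reindex[OF inj]) (auto intro!: sum.cong)
  have "(\<Sum>j\<in>J. u (f j)) = 1"
    unfolding eq[of u] u(2)[symmetric] using \<open>finite I\<close> by (intro sum.mono_neutral_left) auto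
  moreover have "(\<Sum>j\<in>J. u (f j) *\<^sub>R f j) = y"
    unfolding eq[of "\<lambda>z. u z *\<^sub>R z"] u(3)[symmetric] using \<open>finite I\<close> by (intro sum.mono_neutral_left) auto
  moreover have "J \<subseteq> I" using g by (auto simp: J_def)
  moreover have "0 < u (f j)" if "j \<in> J" for j
    using that g u(1) unfolding J_def by (smt (verit, best) image_iff mem_Collect_eq)
  ultimately show ?thesis by (intro that[of J "\<lambda>j. u (f j)"]) auto
qed

lemma compact_Q_set: "compact (Q_set \<alpha> \<delta> N)"
  unfolding Q_set_def by (intro finite_imp_compact_convex_hull) simp

text \<open>Identifies the points over which \<open>S_fun\<close> is finite; a linear projection
  commutes with taking convex hulls.\<close>

lemma fst_Q_set: "fst ` Q_set \<alpha> \<delta> N = convex hull (\<alpha> ` {1..N})"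
  unfolding Q_set_def by (simp add: convex_hull_linear_image linear_fst image_image)

lemma S_fun_attained:
  assumes "\<beta> \<in> convex hull (\<alpha> ` {1..N})"
  obtains s where "S_fun \<alpha> \<delta> N \<beta> = ereal s" "(\<beta>, s) \<in> Q_set \<alpha> \<delta> N"
    "\<And>z. (\<beta>, z) \<in> Q_set \<alpha> \<delta> N \<Longrightarrow> z \<le> s"
proof -
  define F where "F = snd ` (Q_set \<alpha> \<delta> N \<inter> ({\<beta>} \<times> UNIV))"
  have F: "z \<in> F \<longleftrightarrow> (\<beta>, z) \<in> Q_set \<alpha> \<delta> N" for z by (force simp: F_def)
  have "compact F"
    unfolding F_def by (intro compact_continuous_image compact_Int_closed compact_Q_set
        closed_Times continuous_on_snd continuous_on_id) auto
  moreover have ne: "F \<noteq> {}"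
  proof -
    obtain z where "(\<beta>, z) \<in> Q_set \<alpha> \<delta> N"
      using assms unfolding fst_Q_set[of \<alpha> \<delta> N, symmetric] by auto
    then show ?thesis using F by blast
  qed
  ultimately obtain s where s: "s \<in> F" "\<And>z. z \<in> F \<Longrightarrow> z \<le> s"
    using compact_attains_sup by metis
  moreover have "(GREATEST z. (\<beta>, z) \<in> Q_set \<alpha> \<delta> N) = s"
    using s by (intro Greatest_equality) (auto simp: F)
  ultimately show ?thesis
    by (intro that[of s]) (auto simp: S_fun_def F)
qed

text \<open>
  At a relative boundary point of the convex hull an exact support hyperplane needs polyhedrality;
  a hyperplane that passes within \<open>\<epsilon>\<close> above the graph comes from strict separation and suffices.
\<close>

lemma ex_near_support_hyperplane:
  assumes "(\<beta>, s) \<in> Q_set \<alpha> \<delta> N" and "\<And>z. (\<beta>, z) \<in> Q_set \<alpha> \<delta> N \<Longrightarrow> z \<le> s" and \<epsilon>: "0 < \<epsilon>"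
  obtains \<eta> c where "\<And>j. j \<in> {1..N} \<Longrightarrow> ln (1 / \<delta> j) \<le> \<alpha> j \<bullet> \<eta> + c" "\<beta> \<bullet> \<eta> + c \<le> s + \<epsilon>"
proof -
  have "convex (Q_set \<alpha> \<delta> N)" by (simp add: Q_set_def)
  moreover have "closed (Q_set \<alpha> \<delta> N)" by (intro compact_imp_closed compact_Q_set)
  moreover have "(\<beta>, s + \<epsilon>) \<notin> Q_set \<alpha> \<delta> N" using assms(2)[of "s + \<epsilon>"] \<epsilon> by auto
  ultimately obtain w b where w: "w \<bullet> (\<beta>, s + \<epsilon>) < b" "\<And>x. x \<in> Q_set \<alpha> \<delta> N \<Longrightarrow> b < w \<bullet> x"
    using separating_hyperplane_closed_point by metis
  \<comment> \<open>Comparing the separating functional at the heights \<open>s\<close> and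
    \<open>s + \<epsilon>\<close> over the same \<beta> shows \<open>0 < v\<close>, so the
    hyperplane is not vertical and can be solved for the last coordinate.\<close>
  obtain u v where uv: "w = (u, - v)" by (metis minus_minus prod.exhaust)
  have 1: "u \<bullet> \<beta> - v * (s + \<epsilon>) < b" using w(1) by (simp add: uv)
  moreover have "b < u \<bullet> \<beta> - v * s" using w(2)[OF assms(1)] by (simp add: uv)
  ultimately have "0 < v * \<epsilon>" by (simp add: algebra_simps)
  then have v: "0 < v" using \<epsilon> zero_less_mult_pos2 by blast
  show ?thesis
  proof (rule that[of "(1 / v) *\<^sub>R u" "- b / v"])
    fix j assume "j \<in> {1..N}"
    then have "(\<alpha> j, ln (1 / \<delta> j)) \<in> Q_set \<alpha> \<delta> N" unfolding Q_set_def by (intro hull_inc) auto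
    from w(2)[OF this] have "v * ln (1 / \<delta> j) \<le> u \<bullet> \<alpha> j - b" by (simp add: uv)
    then show "ln (1 / \<delta> j) \<le> \<alpha> j \<bullet> (1 / v) *\<^sub>R u + - b / v"
      using v by (simp add: field_simps inner_commute)
  next
    show "\<beta> \<bullet> (1 / v) *\<^sub>R u + - b / v \<le> s + \<epsilon>"
      using v 1 by (simp add: field_simps inner_commute)
  qed
qed

text \<open>Averaging the equation of the hyperplane with the weights \<open>\<theta> j\<close>
  gives its height at \<open>\<alpha> 0\<close>, which is the value of \<open>S_fun\<close> there.
  The right-hand side is the form in which this value enters the AM-GM inequality.\<close>

lemma caratheodory_data_S_fun:
  assumes "caratheodory_data \<alpha> \<delta> N J \<theta>"
  shows "real_of_ereal (S_fun \<alpha> \<delta> N (\<alpha> 0)) = (\<Sum>j\<in>J. \<theta> j * ln (1 / \<delta> j))"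
proof -
  obtain \<eta> c where S: "S_fun \<alpha> \<delta> N (\<alpha> 0) = ereal (\<alpha> 0 \<bullet> \<eta> + c)"
    and c: "\<And>j. j \<in> J \<Longrightarrow> ln (1 / \<delta> j) = \<alpha> j \<bullet> \<eta> + c"
    using assms unfolding caratheodory_data_def support_hyperplane_def by blast
  have \<theta>: "\<alpha> 0 = (\<Sum>j\<in>J. \<theta> j *\<^sub>R \<alpha> j)" "(\<Sum>j\<in>J. \<theta> j) = 1"
    using assms unfolding caratheodory_data_def by auto
  have "(\<Sum>j\<in>J. \<theta> j * ln (1 / \<delta> j)) = (\<Sum>j\<in>J. \<theta> j * (\<alpha> j \<bullet> \<eta>)) + c * (\<Sum>j\<in>J. \<theta> j)"
    using c by (simp add: distrib_left sum.distrib sum_distrib_left mult_ac)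
  also have "\<dots> = \<alpha> 0 \<bullet> \<eta> + c" using \<theta> by (simp add: inner_sum_left)
  finally show ?thesis by (simp add: S)
qed

subsection \<open>The error of optimal recovery\<close>

theorem theorem1:
  fixes \<phi> :: "'k::finite \<Rightarrow> real ^ 'd::finite \<Rightarrow> complex"
    and \<omega> :: "complex \<Rightarrow> real"
    and \<alpha> :: "nat \<Rightarrow> real ^ 'k"
    and \<delta> :: "nat \<Rightarrow> real"
    and p :: ennreal
    and m N :: nat
  defines "\<Lambda> \<equiv> \<Lambda>_op \<omega> \<phi> \<alpha>"
  defines "W \<equiv> W_class p \<Lambda> m N \<delta>"
  defines "s \<equiv> real_of_ereal (S_fun \<alpha> \<delta> N (\<alpha> 0))"
  assumes "1 \<le> m" and "m \<le> N" and "1 \<le> p"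
    and "arg_branch \<omega>"
    and "\<And>i. continuous_on UNIV (\<phi> i)"
    and "\<And>j i. j \<le> N \<Longrightarrow> 0 \<le> \<alpha> j $ i"
    and "\<And>j. j \<in> {1..N} \<Longrightarrow> 0 < \<delta> j"
    and "\<alpha> 0 \<in> convex hull (\<alpha> ` {1..N})"
    and "\<And>a :: 'k \<Rightarrow> real. (\<And>i. 0 < a i) \<Longrightarrow> \<exists>\<xi>. \<forall>i. cmod (\<phi> i \<xi>) = a i"
  shows "optimal_error p \<Lambda> W m \<delta> = ennreal (exp (- s)) \<and>
    (\<forall>J \<theta>. caratheodory_data \<alpha> \<delta> N J \<theta> \<longrightarrow>
      (J \<inter> {1..m} \<noteq> {} \<longrightarrow>
        (\<forall>a. (\<forall>j\<in>J. a j \<in> borel_measurable lebesgue) \<longrightarrow>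
             (AE \<xi> in lebesgue.
                (\<Sum>j\<in>J. multi_power \<omega> \<phi> (\<alpha> j) \<xi> * a j \<xi>) = multi_power \<omega> \<phi> (\<alpha> 0) \<xi>) \<longrightarrow>
             (AE \<xi> in lebesgue. weight_bound p \<delta> J \<theta> s (\<lambda>j. a j \<xi>)) \<longrightarrow>
             optimal_method p \<Lambda> W m \<delta> (\<lambda>y \<xi>. \<Sum>j\<in>J \<inter> {1..m}. a j \<xi> * y j \<xi>))) \<and>
      (J \<inter> {1..m} = {} \<longrightarrow> optimal_method p \<Lambda> W m \<delta> (\<lambda>y \<xi>. 0)))"
proof -
  note \<delta> = assms(10) and \<phi> = assms(8)
  obtain t where t: "S_fun \<alpha> \<delta> N (\<alpha> 0) = ereal t" "(\<alpha> 0, t) \<in> Q_set \<alpha> \<delta> N"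
      "\<And>z. (\<alpha> 0, z) \<in> Q_set \<alpha> \<delta> N \<Longrightarrow> z \<le> t"
    using S_fun_attained[OF assms(11)] by metis
  have "t = s" using t(1) by (simp add: s_def)
  note s = t[unfolded \<open>t = s\<close>]
  have lower: "ennreal (exp (- s)) \<le> recovery_error p \<Lambda> W m \<delta> \<Phi>" if "\<Phi> \<in> recovery_methods p m" for \<Phi>
  proof (cases "recovery_error p \<Lambda> W m \<delta> \<Phi>")
    case (real C)
    \<comment> \<open>One \<epsilon> is lost because the hyperplane supports only approximately, two
      more in the localisation near a point.\<close>
    have "exp (- s - 3 * \<epsilon>) \<le> C" if "0 < \<epsilon>" for \<epsilon>
    proof -
      obtain \<eta> c where \<eta>: "\<And>j. j \<in> {1..N} \<Longrightarrow> ln (1 / \<delta> j) \<le> \<alpha> j \<bullet> \<eta> + c" "\<alpha> 0 \<bullet> \<eta> + c \<le> s + \<epsilon>"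
        using ex_near_support_hyperplane[OF s(2,3) \<open>0 < \<epsilon>\<close>] by metis
      \<comment> \<open>The assumption on the joint range of the moduli supplies a point adapted to
        the slope \<eta>.\<close>
      obtain z where z: "\<And>i. cmod (\<phi> i z) = exp (- \<eta> $ i)"
        using assms(12)[of "\<lambda>i. exp (- \<eta> $ i)"] by auto
      have "ennreal (exp (- (\<alpha> 0 \<bullet> \<eta> + c) - 2 * \<epsilon>)) \<le> recovery_error p \<Lambda> W m \<delta> \<Phi>"
        unfolding W_def \<Lambda>_def
        by (rule recovery_error_ge_of_majorant) (fact assms \<delta> \<phi> \<eta> z \<open>0 < \<epsilon>\<close> \<open>\<Phi> \<in> _\<close>)+
      then have "exp (- (\<alpha> 0 \<bullet> \<eta> + c) - 2 * \<epsilon>) \<le> C" using real by simp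
      moreover have "exp (- s - 3 * \<epsilon>) \<le> exp (- (\<alpha> 0 \<bullet> \<eta> + c) - 2 * \<epsilon>)" using \<eta>(2) by simp
      ultimately show ?thesis by linarith
    qed
    then have ev: "\<forall>\<^sub>F \<epsilon> in at_right 0. exp (- s - 3 * \<epsilon>) \<le> C"
      by (auto simp: eventually_at_right_field intro: exI[of _ 1])
    have "((\<lambda>\<epsilon>. exp (- s - 3 * \<epsilon>)) \<longlongrightarrow> exp (- s - 3 * 0)) (at_right 0)" by (intro tendsto_intros)
    then have "exp (- s) \<le> C" using tendsto_upperbound[OF _ ev] by simp
    then show ?thesis using real by (simp add: ennreal_leI)
  qed simp
  \<comment> \<open>Stated for arbitrary positive weights summing to 1 rather than for
    \<open>caratheodory_data\<close>, so that it also applies to weights read off directly from the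
    hull.\<close>
  have upper: "(\<lambda>y \<xi>. \<Sum>j\<in>J \<inter> {1..m}. a j \<xi> * y j \<xi>) \<in> recovery_methods p m \<and>
      recovery_error p \<Lambda> W m \<delta> (\<lambda>y \<xi>. \<Sum>j\<in>J \<inter> {1..m}. a j \<xi> * y j \<xi>) = ennreal (exp (- s))"
    if J: "J \<subseteq> {1..N}" "\<And>j. j \<in> J \<Longrightarrow> 0 < \<theta> j" "(\<Sum>j\<in>J. \<theta> j) = 1"
      and a: "\<And>j. j \<in> J \<Longrightarrow> a j \<in> borel_measurable lebesgue"
      "AE \<xi> in lebesgue. (\<Sum>j\<in>J. multi_power \<omega> \<phi> (\<alpha> j) \<xi> * a j \<xi>) = multi_power \<omega> \<phi> (\<alpha> 0) \<xi>"
      "AE \<xi> in lebesgue. weight_bound p \<delta> J \<theta> s (\<lambda>j. a j \<xi>)" for J \<theta> a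
  proof -
    have \<delta>J: "0 < \<delta> j" if "j \<in> J" for j using \<delta> J(1) that by auto
    have "finite J" using J(1) finite_subset by blast
    then have "(\<lambda>y \<xi>. \<Sum>j\<in>J \<inter> {1..m}. a j \<xi> * y j \<xi>) \<in> recovery_methods p m"
      using assms(6) J \<delta>J a by (intro recovery_method_linear)
    moreover have "recovery_error p \<Lambda> W m \<delta> (\<lambda>y \<xi>. \<Sum>j\<in>J \<inter> {1..m}. a j \<xi> * y j \<xi>) \<le> ennreal (exp (- s))"
      unfolding W_def \<Lambda>_def using assms(6-8) J \<delta>J a by (intro recovery_error_le)
    ultimately show ?thesis using lower by (simp add: antisym)
  qed
  have ex: "\<exists>a. (\<forall>j. a j \<in> borel_measurable lebesgue) \<and>
      (\<forall>\<xi>. (\<Sum>j\<in>J. multi_power \<omega> \<phi> (\<alpha> j) \<xi> * a j \<xi>) = multi_power \<omega> \<phi> (\<alpha> 0) \<xi>) \<and>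
      (\<forall>\<xi>. weight_bound p \<delta> J \<theta> s (\<lambda>j. a j \<xi>))"
    if J: "J \<subseteq> {1..N}" "\<And>j. j \<in> J \<Longrightarrow> 0 < \<theta> j" "(\<Sum>j\<in>J. \<theta> j) = 1"
      "\<alpha> 0 = (\<Sum>j\<in>J. \<theta> j *\<^sub>R \<alpha> j)" "s = (\<Sum>j\<in>J. \<theta> j * ln (1 / \<delta> j))" for J \<theta>
  proof -
    have JN: "0 < \<delta> j" "0 \<le> \<alpha> j $ i" if "j \<in> J" for i j using assms(9) \<delta> J(1) that by auto
    have "finite J" using J(1) finite_subset by blast
    show ?thesis
      by (rule ex_recovery_weights[where \<phi> = \<phi>, OF assms(6-8) \<open>finite J\<close> J(2,3) JN(2,1) J(4,5)]) blast+
  qed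
  \<comment> \<open>The point \<open>(\<alpha> 0, s)\<close> of the hull itself supplies weights, so
    the value of the optimal error is established independently of any
    \<open>caratheodory_data\<close>.\<close>
  obtain J0 \<theta>0 where J0: "J0 \<subseteq> {1..N}" "\<And>j. j \<in> J0 \<Longrightarrow> 0 < \<theta>0 j" "(\<Sum>j\<in>J0. \<theta>0 j) = 1"
    and eq0: "(\<alpha> 0, s) = (\<Sum>j\<in>J0. \<theta>0 j *\<^sub>R (\<alpha> j, ln (1 / \<delta> j)))"
    by (rule convex_hull_image_finite_weights[OF finite_atLeastAtMost s(2)[unfolded Q_set_def]]) blast
  have "\<alpha> 0 = (\<Sum>j\<in>J0. \<theta>0 j *\<^sub>R \<alpha> j)" "s = (\<Sum>j\<in>J0. \<theta>0 j * ln (1 / \<delta> j))"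
    using arg_cong[OF eq0, of fst] arg_cong[OF eq0, of snd] by (simp_all add: fst_sum snd_sum)
  from ex[OF J0 this] obtain a where "\<And>j. a j \<in> borel_measurable lebesgue"
    "\<And>\<xi>. (\<Sum>j\<in>J0. multi_power \<omega> \<phi> (\<alpha> j) \<xi> * a j \<xi>) = multi_power \<omega> \<phi> (\<alpha> 0) \<xi>"
    "\<And>\<xi>. weight_bound p \<delta> J0 \<theta>0 s (\<lambda>j. a j \<xi>)"
    by blast
  with upper[OF J0, of a] obtain \<Phi> where
    "\<Phi> \<in> recovery_methods p m" "recovery_error p \<Lambda> W m \<delta> \<Phi> = ennreal (exp (- s))"
    by auto
  then have opt: "optimal_error p \<Lambda> W m \<delta> = ennreal (exp (- s))"
    unfolding optimal_error_def using lower by (intro antisym INF_greatest) (auto intro: INF_lower2)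
  show ?thesis
  proof (intro conjI allI impI opt)
    fix J \<theta> a
    assume data: "caratheodory_data \<alpha> \<delta> N J \<theta>"
      and a: "\<forall>j\<in>J. a j \<in> borel_measurable lebesgue"
      "AE \<xi> in lebesgue. (\<Sum>j\<in>J. multi_power \<omega> \<phi> (\<alpha> j) \<xi> * a j \<xi>) = multi_power \<omega> \<phi> (\<alpha> 0) \<xi>"
      "AE \<xi> in lebesgue. weight_bound p \<delta> J \<theta> s (\<lambda>j. a j \<xi>)"
    then show "optimal_method p \<Lambda> W m \<delta> (\<lambda>y \<xi>. \<Sum>j\<in>J \<inter> {1..m}. a j \<xi> * y j \<xi>)"
      unfolding optimal_method_def opt by (intro upper) (auto simp: caratheodory_data_def)
  next
    fix J \<theta>
    assume data: "caratheodory_data \<alpha> \<delta> N J \<theta>" and M: "J \<inter> {1..m} = {}"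
    have J: "J \<subseteq> {1..N}" "\<And>j. j \<in> J \<Longrightarrow> 0 < \<theta> j" "(\<Sum>j\<in>J. \<theta> j) = 1" "\<alpha> 0 = (\<Sum>j\<in>J. \<theta> j *\<^sub>R \<alpha> j)"
      using data unfolding caratheodory_data_def by auto
    \<comment> \<open>Admissible weights exist in this case too; as \<open>J \<inter> {1..m}\<close>
      is empty, the linear method built from them is an empty sum, that is, the zero method.\<close>
    obtain a where "\<And>j. a j \<in> borel_measurable lebesgue"
      "\<And>\<xi>. (\<Sum>j\<in>J. multi_power \<omega> \<phi> (\<alpha> j) \<xi> * a j \<xi>) = multi_power \<omega> \<phi> (\<alpha> 0) \<xi>"
      "\<And>\<xi>. weight_bound p \<delta> J \<theta> s (\<lambda>j. a j \<xi>)"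
      using ex[OF J] caratheodory_data_S_fun[OF data] s_def by blast
    then show "optimal_method p \<Lambda> W m \<delta> (\<lambda>y \<xi>. 0)"
      unfolding optimal_method_def opt using upper[OF J(1-3), of a, unfolded M sum.empty] by simp
  qed
qed

end
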